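(* Let $c=e^{2\pi}/1728$. There is a constant $C_0$ such that for every even $k\ge4$ and every integer $0\le m\le\ell$, every zero $z\in\mathcal F$ of the Miller form $g_{k,m}$ satisfies \[\Im z<\frac{2\log k}{1-c}+C_0.\]
   Context: $\mathfrak H$ is the upper half-plane, $q=e^{2\pi iz}$, $\mathcal F=\{z\in\mathfrak H:|\Re z|\le1/2,|z|\ge1\}$. For an even integer $k\ge4$ write $k=12\ell+k'$ with $k'\in\{0,4,6,8,10,14\}$, so $\ell+1=\dim M_k$ ($M_k$ the holomorphic level-one modular forms of weight $k$). For $0\le m\le\ell$ the Miller form $g_{k,m}$ is the unique element of $M_k$ with $q$-expansion $q^m+O(q^{\ell+1})$. *)

theory Defs
  imports "HOL-Complex_Analysis.Complex_Analysis"
begin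

definition upper_half_plane :: "complex set" where
  "upper_half_plane = {z. Im z > 0}"

definition fund_domain :: "complex set" where
  "fund_domain = {z. Im z > 0 \<and> \<bar>Re z\<bar> \<le> 1/2 \<and> cmod z \<ge> 1}"

definition qvar :: "complex \<Rightarrow> complex" where
  "qvar z = exp (2 * of_real pi * \<i> * z)"

text \<open>Holomorphic level-one modular forms of weight k: holomorphic on the upper
  half-plane, invariant under z -> z+1, transforming with z^k under z -> -1/z,
  and holomorphic at the cusp (bounded as Im z -> infinity).\<close>
definition modular_form :: "nat \<Rightarrow> (complex \<Rightarrow> complex) \<Rightarrow> bool" where
  "modular_form k f \<longleftrightarrow>
     f holomorphic_on upper_half_plane \<and>
     (\<forall>z\<in>upper_half_plane. f (z + 1) = f z) \<and>
     (\<forall>z\<in>upper_half_plane. f (- 1 / z) = z ^ k * f z) \<and>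
     (\<exists>B. \<forall>z. Im z \<ge> 1 \<longrightarrow> cmod (f z) \<le> B)"

text \<open>For even k \<ge> 4, k = 12 ell + k' with k' in {0,4,6,8,10,14}.\<close>
definition miller_ell :: "nat \<Rightarrow> nat" where
  "miller_ell k = (if k mod 12 = 2 then k div 12 - 1 else k div 12)"

definition qexp_leading :: "(complex \<Rightarrow> complex) \<Rightarrow> nat \<Rightarrow> nat \<Rightarrow> bool" where
  "qexp_leading f m N \<longleftrightarrow>
     (\<exists>B. \<forall>z. Im z \<ge> 1 \<longrightarrow> cmod (f z - qvar z ^ m) \<le> B * cmod (qvar z) ^ N)"

definition miller_form :: "nat \<Rightarrow> nat \<Rightarrow> (complex \<Rightarrow> complex) \<Rightarrow> bool" where
  "miller_form k m g \<longleftrightarrow> modular_form k g \<and> qexp_leading g m (miller_ell k + 1)"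

end

theory Submission
  imports Defs
begin

text \<open>
  Write \<open>w = 1/j = q + O(q\<^sup>2)\<close> and \<open>d = \<ell> - m\<close>. Multiplying \<open>g\<close> by \<open>E\<^sub>4\<^sup>a E\<^sub>6\<^sup>b\<close> to reach a weight divisible
  by 12 and dividing by a power of \<open>\<Delta>\<close> gives a polynomial in \<open>j\<close>; its forced zeros at \<open>j = 0\<close> and
  \<open>j = 1728\<close> split off, leaving \<open>F(j)\<close> with \<open>F\<close> of degree at most \<open>d\<close>. The condition
  \<open>g = q\<^sup>m + O(q\<^bsup>\<ell>+1\<^esup>)\<close> says exactly that \<open>w\<^sup>d F(1/w)\<close> is the degree \<open>d\<close> Taylor polynomial of an
  explicit function \<open>V(w)\<close> with \<open>V(0) = 1\<close>, a product of at most \<open>2k\<close> factors \<open>1 + O(w)\<close> and one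
  bounded factor. So \<open>V\<close> is bounded on \<open>|w| \<le> c/k\<close> independently of \<open>k\<close> and \<open>m\<close>, and Cauchy's
  estimates show that the Taylor polynomial has no zero with \<open>|w| \<le> c'/k\<close>. Hence zeros of \<open>g\<close>
  satisfy \<open>|q| \<ge> c''/k\<close>, that is \<open>Im z \<le> log k / (2\<pi>) + C\<^sub>0\<close>, which is stronger than the claim.

  The function \<open>\<Delta>\<close> is obtained by integrating \<open>E\<^sub>2\<close>, so that it has no zeros by construction; its
  modularity comes from that of \<open>E\<^sub>2\<close>, proved by rearranging the double series
  \<open>\<Sum> 1/(m + n z)\<^sup>2\<close>. Functions of weight 0 bounded at the cusp are constant by the maximum principle on
  the \<open>q\<close>-disc, so no valence formula is needed.
\<close>

section \<open>Partial fractions\<close>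

lemma sum_symmetric_int:
  fixes f :: "int \<Rightarrow> 'a::comm_monoid_add"
  shows "(\<Sum>m\<in>{-int N..<int N}. f m) = (\<Sum>n<N. f (int n) + f (- int n - 1))"
proof (induction N)
  case 0
  then show ?case by simp
next
  case (Suc N)
  have "{-int (Suc N)..<int (Suc N)} = insert (int N) (insert (-int N - 1) {-int N..<int N})"
    by auto
  then show ?case using Suc by (simp add: algebra_simps)
qed

lemma UNIV_int_split: "(UNIV :: int set) = range int \<union> (range (\<lambda>n. - int n) - range int)"
proof -
  have "x \<in> range int \<union> (range (\<lambda>n. - int n) - range int)" for x
    by (cases x rule: int_cases2) auto
  then show ?thesis by blast
qed

text \<open>Pairing n with -n-1 runs through every integer exactly once, with no separate term at 0.
  The windows \<open>{-int N..<int N}\<close> exhaust the integers, so an unordered sum is also the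
  limit of these ordered sums.\<close>

lemma has_sum_int_LIMSEQ:
  fixes f :: "int \<Rightarrow> 'a::{comm_monoid_add,topological_space}"
  assumes "(f has_sum s) UNIV"
  shows "(\<lambda>N. \<Sum>n<N. f (int n) + f (- int n - 1)) \<longlonglongrightarrow> s"
proof -
  have "(sum f \<longlongrightarrow> s) (finite_subsets_at_top UNIV)"
    using assms by (simp add: has_sum_def)
  moreover have "filterlim (\<lambda>N. {-int N..<int N}) (finite_subsets_at_top UNIV) sequentially"
    unfolding filterlim_finite_subsets_at_top
  proof (intro allI impI)
    fix X :: "int set" assume X: "finite X \<and> X \<subseteq> UNIV"
    then obtain b where b: "\<And>x. x \<in> X \<Longrightarrow> \<bar>x\<bar> \<le> b"
      by (metis finite_imageI Max_ge imageI)
    have "X \<subseteq> {-int N..<int N}" if "N \<ge> nat (b + 1)" for N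
    proof
      fix x assume "x \<in> X"
      from b[OF this] that show "x \<in> {-int N..<int N}" by auto
    qed
    then show "\<forall>\<^sub>F N in sequentially. finite {-int N..<int N} \<and> X \<subseteq> {-int N..<int N} \<and> {-int N..<int N} \<subseteq> UNIV"
      by (intro eventually_sequentiallyI[of "nat (b + 1)"]) auto
  qed
  ultimately have "((\<lambda>N. sum f {-int N..<int N}) \<longlongrightarrow> s) sequentially"
    by (rule filterlim_compose)
  then show ?thesis by (simp add: sum_symmetric_int)
qed

text \<open>Summability comes from majorants; after that only the value is open, and a single
  ordering of the terms determines it.\<close>

lemma has_sum_intI:
  fixes f :: "int \<Rightarrow> 'a::{comm_monoid_add,t2_space}"
  assumes "f summable_on UNIV" "(\<lambda>N. \<Sum>n<N. f (int n) + f (- int n - 1)) \<longlonglongrightarrow> s"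
  shows "(f has_sum s) UNIV"
  using assms has_sum_int_LIMSEQ[OF has_sum_infsum[OF assms(1)]]
  by (metis LIMSEQ_unique has_sum_infsum)

lemma summable_on_inverse_squares_int: "(\<lambda>m::int. 1 / (1 + (of_int m)\<^sup>2 :: real)) summable_on UNIV"
proof -
  let ?f = "\<lambda>m::int. 1 / (1 + (of_int m)\<^sup>2 :: real)"
  have U: "(UNIV :: int set) = range int \<union> (range (\<lambda>n. - int n) - range int)"
    by (rule UNIV_int_split)
  have s: "(\<lambda>n::nat. 1 / (1 + (of_nat n)\<^sup>2 :: real)) summable_on UNIV"
  proof (rule norm_summable_imp_summable_on)
    show "summable (\<lambda>n::nat. norm (1 / (1 + (of_nat n)\<^sup>2 :: real)))"
    proof (rule summable_comparison_test')
      show "summable (\<lambda>n. inverse (real n ^ 2))"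
        by (rule inverse_power_summable) simp
    next
      fix n :: nat assume n: "n \<ge> 1"
      show "norm (norm (1 / (1 + (of_nat n)\<^sup>2 :: real))) \<le> inverse (real n ^ 2)"
        unfolding real_norm_def abs_abs abs_divide abs_one inverse_eq_divide
        by (rule frac_le) (use n in \<open>auto simp: abs_if\<close>)
    qed
  qed
  have "?f summable_on range int"
    by (subst summable_on_reindex) (auto simp: o_def s)
  moreover have "?f summable_on range (\<lambda>n. - int n)"
    by (subst summable_on_reindex) (auto simp: o_def s inj_on_def)
  then have "?f summable_on (range (\<lambda>n. - int n) - range int)"
    by (rule summable_on_subset[OF _ Diff_subset])
  ultimately show ?thesis
    unfolding U by (rule summable_on_Un_disjoint) (rule Diff_disjoint)
qed

section \<open>Reflection formulas and the cotangent series\<close>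

lemma Digamma_reflection:
  assumes "z \<notin> \<int>"
  shows "Digamma z - Digamma (1 - z) = - of_real pi * cot (of_real pi * z :: complex)"
proof -
  have z: "z \<notin> \<int>\<^sub>\<le>\<^sub>0" "1 - z \<notin> \<int>\<^sub>\<le>\<^sub>0"
    using assms nonpos_Ints_Int Ints_diff[of 1 "1 - z"] by auto
  have s: "sin (of_real pi * z) \<noteq> 0"
    using assms by (auto simp: sin_eq_0 mult.commute)
  \<comment> \<open>Logarithmic differentiation of Euler's reflection formula: both sides are
    differentiated and the common factor \<open>pi / sin (pi * z)\<close> is divided out.\<close>
  have d: "((\<lambda>z. Gamma z * Gamma (1 - z)) has_field_derivative
      Gamma z * Gamma (1 - z) * (Digamma z - Digamma (1 - z))) (at z)"
    using z by (auto intro!: derivative_eq_intros simp: algebra_simps)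
  have "((\<lambda>z. of_real pi / sin (of_real pi * z)) has_field_derivative
      - (of_real pi * of_real pi * cos (of_real pi * z)) / (sin (of_real pi * z))\<^sup>2) (at z)"
    using s by (auto intro!: derivative_eq_intros simp: power2_eq_square)
  with d have "Gamma z * Gamma (1 - z) * (Digamma z - Digamma (1 - z)) =
      - (of_real pi * of_real pi * cos (of_real pi * z)) / (sin (of_real pi * z))\<^sup>2"
    unfolding Gamma_reflection_complex by (rule DERIV_unique)
  then have *: "of_real pi / sin (of_real pi * z) * (Digamma z - Digamma (1 - z)) =
      - (of_real pi * of_real pi * cos (of_real pi * z)) / (sin (of_real pi * z))\<^sup>2"
    by (simp only: Gamma_reflection_complex)
  have "Digamma z - Digamma (1 - z) =
      of_real pi / sin (of_real pi * z) * (Digamma z - Digamma (1 - z)) * (sin (of_real pi * z) / of_real pi)"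
    using s by simp
  also have "\<dots> = - of_real pi * cot (of_real pi * z)"
    unfolding * using s by (simp add: cot_def power2_eq_square)
  finally show ?thesis .
qed

text \<open>One more derivative of the digamma reflection formula, which holds on the open
  complement of the integers and may therefore be differentiated.\<close>

lemma Polygamma_1_reflection:
  assumes "z \<notin> \<int>"
  shows "Polygamma 1 z + Polygamma 1 (1 - z) = (of_real pi)\<^sup>2 / (sin (of_real pi * z :: complex))\<^sup>2"
proof -
  have z: "z \<notin> \<int>\<^sub>\<le>\<^sub>0" "1 - z \<notin> \<int>\<^sub>\<le>\<^sub>0"
    using assms nonpos_Ints_Int Ints_diff[of 1 "1 - z"] by auto
  have s: "sin (of_real pi * z) \<noteq> 0"
    using assms by (auto simp: sin_eq_0 mult.commute)
  have d: "((\<lambda>z. Digamma z - Digamma (1 - z)) has_field_derivative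
      Polygamma 1 z + Polygamma 1 (1 - z)) (at z)"
    using z by (auto intro!: derivative_eq_intros simp: algebra_simps)
  have e: "((\<lambda>z. - of_real pi * cot (of_real pi * z)) has_field_derivative
      (of_real pi)\<^sup>2 / (sin (of_real pi * z))\<^sup>2) (at z)"
    using s by (auto intro!: derivative_eq_intros DERIV_chain2[OF DERIV_cot] simp: power2_eq_square field_simps)
  have "open (- \<int> :: complex set)"
    by (simp add: closed_Ints open_Compl)
  then have "((\<lambda>z. - of_real pi * cot (of_real pi * z)) has_field_derivative
      Polygamma 1 z + Polygamma 1 (1 - z)) (at z)"
    using assms by (intro has_field_derivative_transform_within_open[OF d, of "-\<int>"]) (auto simp: Digamma_reflection)
  from DERIV_unique[OF this e] show ?thesis .
qed

text \<open>Both digamma values are limits of a logarithm minus a harmonic-type sum. In their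
  difference the logarithms cancel, and the two sums interleave into the pairing of n with
  -n-1.\<close>

lemma cot_LIMSEQ:
  assumes "z \<notin> \<int>"
  shows "(\<lambda>N. \<Sum>n<N. 1 / (of_int (int n) + z) + 1 / (of_int (- int n - 1) + z))
           \<longlonglongrightarrow> of_real pi * cot (of_real pi * z :: complex)"
proof -
  have z: "z \<noteq> 0" "1 - z \<noteq> 0" using assms by auto
  have "(\<lambda>m. (of_real (ln (real m)) - (\<Sum>n<m. inverse (1 - z + of_nat n)))
           - (of_real (ln (real m)) - (\<Sum>n<m. inverse (z + of_nat n))))
      \<longlonglongrightarrow> Digamma (1 - z) - Digamma z"
    by (intro tendsto_diff Digamma_LIMSEQ z)
  moreover have "(\<lambda>m. (of_real (ln (real m)) - (\<Sum>n<m. inverse (1 - z + of_nat n)))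
           - (of_real (ln (real m)) - (\<Sum>n<m. inverse (z + of_nat n))))
    = (\<lambda>N. \<Sum>n<N. 1 / (of_int (int n) + z) + 1 / (of_int (- int n - 1) + z))"
  proof
    fix m
    have *: "1 / (of_int (- int n - 1) + z) = - inverse (1 - z + of_nat n)" for n
    proof -
      have "of_int (- int n - 1) + z = - (1 - z + of_nat n)" by simp
      then show ?thesis by (simp only: inverse_eq_divide minus_divide_right)
    qed
    show "(of_real (ln (real m)) - (\<Sum>n<m. inverse (1 - z + of_nat n)))
           - (of_real (ln (real m)) - (\<Sum>n<m. inverse (z + of_nat n))) =
       (\<Sum>n<m. 1 / (of_int (int n) + z) + 1 / (of_int (- int n - 1) + z))"
      unfolding * sum.distrib sum_negf of_int_of_nat_eq inverse_eq_divide add.commute[of z] by simp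
  qed
  moreover have "Digamma (1 - z) - Digamma z = of_real pi * cot (of_real pi * z)"
    using arg_cong[OF Digamma_reflection[OF assms], of uminus] by simp
  ultimately show ?thesis by simp
qed

text \<open>The trigamma values at z and 1 - z are the sums of 1/(n + z)^2 over n >= 0 and over n <
  0, so their reflection formula evaluates the sum over all integers.\<close>

lemma sin_squared_LIMSEQ:
  assumes "z \<notin> \<int>"
  shows "(\<lambda>N. \<Sum>n<N. 1 / (of_int (int n) + z)\<^sup>2 + 1 / (of_int (- int n - 1) + z)\<^sup>2)
           \<longlonglongrightarrow> (of_real pi)\<^sup>2 / (sin (of_real pi * z :: complex))\<^sup>2"
proof -
  have z: "z \<noteq> 0" "1 - z \<noteq> 0" using assms by auto
  have "(\<lambda>n. inverse ((z + of_nat n)\<^sup>2)) sums Polygamma 1 z" if "z \<noteq> 0" for z :: complex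
    using Polygamma_LIMSEQ[OF that, of 1] by (simp add: numeral_2_eq_2)
  from sums_add[OF this[OF z(1)] this[OF z(2)]]
  have "(\<lambda>n. inverse ((z + of_nat n)\<^sup>2) + inverse ((1 - z + of_nat n)\<^sup>2)) sums
     ((of_real pi)\<^sup>2 / (sin (of_real pi * z))\<^sup>2)"
    unfolding Polygamma_1_reflection[OF assms] .
  moreover have "inverse ((z + of_nat n)\<^sup>2) + inverse ((1 - z + of_nat n)\<^sup>2) =
     1 / (of_int (int n) + z)\<^sup>2 + 1 / (of_int (- int n - 1) + z)\<^sup>2" for n
  proof -
    have "of_int (- int n - 1) + z = - (1 - z + of_nat n)" by simp
    then have "(of_int (- int n - 1) + z)\<^sup>2 = (1 - z + of_nat n)\<^sup>2"
      by (simp only: power2_minus)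
    then show ?thesis by (simp only: inverse_eq_divide of_int_of_nat_eq add.commute)
  qed
  ultimately show ?thesis by (simp add: sums_def)
qed

section \<open>The nome and the Lambert series of \<open>E\<^sub>2\<close>\<close>

lemma qvar_nonzero [simp]: "qvar z \<noteq> 0"
  by (simp add: qvar_def)

lemma norm_qvar: "norm (qvar z) = exp (- 2 * pi * Im z)"
  by (simp add: qvar_def)

lemma norm_qvar_less_1: "Im z > 0 \<Longrightarrow> norm (qvar z) < 1"
  by (simp add: norm_qvar mult_neg_pos)

lemma qvar_add_1: "qvar (z + 1) = qvar z"
  by (simp add: qvar_def ring_distribs exp_add exp_two_pi_i)

lemma qvar_of_nat_mult: "qvar (of_nat n * z) = qvar z ^ n"
  unfolding qvar_def exp_of_nat_mult [symmetric] by (simp add: algebra_simps)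

lemma one_minus_power_nonzero:
  fixes q :: complex
  assumes "norm q < 1" "n > 0"
  shows "1 - q ^ n \<noteq> 0"
proof
  assume "1 - q ^ n = 0"
  then have "norm q ^ n = 1" by (metis norm_one norm_power right_minus_eq)
  moreover have "norm q ^ n < 1" using assms by (simp add: power_less_one_iff)
  ultimately show False by simp
qed

text \<open>With u = exp(i pi w) the sine is (u - 1/u)/(2i); squaring leaves only u^2 =
  \<open>qvar w\<close>, so the squared sine is a rational function of the nome.\<close>

lemma sin_squared_qvar: "(sin (of_real pi * w))\<^sup>2 = - (1 - qvar w)\<^sup>2 / (4 * qvar w)"
proof -
  define u where "u = exp (\<i> * (of_real pi * w))"
  have u: "u \<noteq> 0" by (simp add: u_def)
  have q: "qvar w = u\<^sup>2"
    by (simp add: qvar_def u_def exp_double [symmetric] algebra_simps)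
  have "sin (of_real pi * w) = (u - 1 / u) / (2 * \<i>)"
    by (simp add: sin_exp_eq u_def exp_minus inverse_eq_divide)
  then show ?thesis using u
    by (simp add: q power_divide power_mult_distrib) (simp add: field_simps power2_eq_square)
qed

text \<open>This is (\<open>E\<^sub>2\<close> - 1)/q, using that the sum of n q^n/(1 - q^n) equals
  the sum of q^n/(1 - q^n)^2. With the factor q removed it can be integrated over the whole disc,
  which later yields a logarithm of \<open>delta q / q\<close>.\<close>

definition eisenstein2s :: "complex \<Rightarrow> complex" where
  "eisenstein2s q = - 24 * (\<Sum>n. q ^ n / (1 - q ^ Suc n)\<^sup>2)"

definition eisenstein2 :: "complex \<Rightarrow> complex" where
  "eisenstein2 q = 1 + q * eisenstein2s q"

text \<open>Since |q|^(n+1) <= r, each denominator has norm at least (1 - r)^2. The resulting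
  geometric majorant is uniform on |q| <= r.\<close>

lemma lambert_term_bound:
  fixes q :: complex
  assumes "norm q \<le> r" "r < 1"
  shows "norm (q ^ n / (1 - q ^ Suc n)\<^sup>2) \<le> r ^ n / (1 - r)\<^sup>2"
proof -
  have r: "r \<ge> 0" using assms norm_ge_zero order_trans by blast
  have "norm (q ^ Suc n) \<le> r"
    unfolding norm_power using assms r power_mono[of "norm q" r "Suc n"] power_Suc_le_self[of r n]
    by (meson less_imp_le norm_ge_zero order_trans power_decreasing)
  moreover have "1 - norm (q ^ Suc n) \<le> norm (1 - q ^ Suc n)"
    by (metis norm_one norm_triangle_ineq2)
  ultimately have "1 - r \<le> norm (1 - q ^ Suc n)" by linarith
  then have "(1 - r)\<^sup>2 \<le> (norm (1 - q ^ Suc n))\<^sup>2"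
    using assms by (intro power_mono) auto
  then show ?thesis unfolding norm_divide norm_power
    using assms r by (intro frac_le power_mono) auto
qed

lemma summable_geometric_bound: "0 \<le> r \<Longrightarrow> r < 1 \<Longrightarrow> summable (\<lambda>n. r ^ n / (1 - r)\<^sup>2 :: real)"
  by (intro summable_divide summable_geometric) auto

lemma eisenstein2s_holomorphic [holomorphic_intros]: "eisenstein2s holomorphic_on ball 0 1"
proof -
  have "(\<lambda>q. \<Sum>n. q ^ n / (1 - q ^ Suc n)\<^sup>2) holomorphic_on ball (0::complex) 1"
  proof (rule holomorphic_uniform_sequence)
    show "(\<lambda>q. \<Sum>n<N. q ^ n / (1 - q ^ Suc n)\<^sup>2) holomorphic_on ball (0::complex) 1" for N
      by (intro holomorphic_intros) (use one_minus_power_nonzero[of _ "Suc _"] in auto)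
  next
    fix x :: complex assume x: "x \<in> ball 0 1"
    define d where "d = (1 - norm x) / 2"
    have d: "d > 0" "norm x + d < 1" using x by (auto simp: d_def field_simps)
    have n: "norm y \<le> norm x + d" if "y \<in> cball x d" for y
      using that norm_triangle_ineq2[of y x] by (simp add: dist_norm norm_minus_commute)
    have "uniform_limit (cball x d) (\<lambda>N q. \<Sum>n<N. q ^ n / (1 - q ^ Suc n)\<^sup>2)
         (\<lambda>q. \<Sum>n. q ^ n / (1 - q ^ Suc n)\<^sup>2) sequentially"
      using d n lambert_term_bound[OF n d(2)] by (intro Weierstrass_m_test summable_geometric_bound) auto
    moreover have "cball x d \<subseteq> ball 0 1"
      using n d(2) by fastforce
    ultimately show "\<exists>d>0. cball x d \<subseteq> ball 0 1 \<and> uniform_limit (cball x d)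
          (\<lambda>N q. \<Sum>n<N. q ^ n / (1 - q ^ Suc n)\<^sup>2) (\<lambda>q. \<Sum>n. q ^ n / (1 - q ^ Suc n)\<^sup>2) sequentially"
      using d(1) by blast
  qed auto
  then have "(\<lambda>q. - 24 * (\<Sum>n. q ^ n / (1 - q ^ Suc n)\<^sup>2)) holomorphic_on ball (0::complex) 1"
    by (intro holomorphic_intros)
  then show ?thesis by (simp add: eisenstein2s_def [abs_def])
qed

lemma eisenstein2_holomorphic [holomorphic_intros]: "eisenstein2 holomorphic_on ball 0 1"
  unfolding eisenstein2_def [abs_def] by (intro holomorphic_intros)

lemma eisenstein2s_0: "eisenstein2s 0 = - 24"
proof -
  have "(\<lambda>n. 0 ^ n / (1 - 0 ^ Suc n)\<^sup>2 :: complex) sums (\<Sum>n\<in>{0}. 0 ^ n / (1 - 0 ^ Suc n)\<^sup>2)"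
    by (rule sums_finite) auto
  then show ?thesis by (simp add: eisenstein2s_def sums_iff)
qed

text \<open>The value of the sum of 1/(m + n z)^2 over all integers m, as a function of q. The row n
  = 0 is 2 zeta(2), because its term m = 0 is 1/0 = 0; the other rows come from pi^2/sin^2.\<close>

definition eis_row :: "complex \<Rightarrow> int \<Rightarrow> complex" where
  "eis_row q n = (if n = 0 then (of_real pi)\<^sup>2 / 3
     else - 4 * (of_real pi)\<^sup>2 * (q ^ nat \<bar>n\<bar> / (1 - q ^ nat \<bar>n\<bar>)\<^sup>2))"

lemma eis_row_minus: "eis_row q (- n) = eis_row q n"
  by (simp add: eis_row_def)

lemma eis_rows_has_sum:
  assumes q: "norm q < 1"
  shows "(eis_row q has_sum ((of_real pi)\<^sup>2 / 3 * eisenstein2 q)) UNIV"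
proof (rule has_sum_intI)
  \<comment> \<open>At n = 0 the truncated exponent is 0, so one geometric majorant covers the
    exceptional row as well.\<close>
  have b: "norm (eis_row q n) \<le> 4 * pi\<^sup>2 / (1 - norm q)\<^sup>2 * norm q ^ (nat \<bar>n\<bar> - 1)" for n
  proof (cases "n = 0")
    case True
    have "(1 - norm q)\<^sup>2 \<le> 1" "(1 - norm q)\<^sup>2 > 0"
      using q by (simp_all add: power_le_one)
    then have "pi\<^sup>2 / 3 \<le> 4 * pi\<^sup>2 / (1 - norm q)\<^sup>2"
      by (intro frac_le) auto
    then show ?thesis using True by (simp add: eis_row_def norm_divide norm_power)
  next
    case False
    then obtain k where k: "nat \<bar>n\<bar> = Suc k" by (metis nat_eq_iff2 abs_eq_0 gr0_implies_Suc zero_less_nat_eq zero_less_abs_iff)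
    have "norm (eis_row q n) = 4 * pi\<^sup>2 * (norm q * norm (q ^ k / (1 - q ^ Suc k)\<^sup>2))"
      using False by (simp add: eis_row_def k norm_mult norm_divide norm_power)
    also have "\<dots> \<le> 4 * pi\<^sup>2 * (1 * (norm q ^ k / (1 - norm q)\<^sup>2))"
      using q by (intro mult_left_mono mult_mono lambert_term_bound) auto
    finally show ?thesis by (simp add: k)
  qed
  have s: "(\<lambda>n. 4 * pi\<^sup>2 / (1 - norm q)\<^sup>2 * norm q ^ (nat \<bar>n\<bar> - 1)) summable_on (UNIV :: int set)"
  proof (rule summable_on_cmult_right)
    have a: "(\<lambda>n::nat. norm q ^ (n - Suc 0)) summable_on UNIV"
    proof (rule norm_summable_imp_summable_on)
      show "summable (\<lambda>n. norm (norm q ^ (n - Suc 0)))"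
        using q by (subst summable_Suc_iff [symmetric]) (simp add: norm_power)
    qed
    have U: "(UNIV :: int set) = range int \<union> (range (\<lambda>n. - int n) - range int)"
      by (rule UNIV_int_split)
    have "(\<lambda>n::int. norm q ^ (nat \<bar>n\<bar> - 1)) summable_on range int"
      by (subst summable_on_reindex) (auto simp: o_def a)
    moreover have "(\<lambda>n::int. norm q ^ (nat \<bar>n\<bar> - 1)) summable_on range (\<lambda>n. - int n)"
      by (subst summable_on_reindex) (auto simp: o_def a inj_on_def)
    then have "(\<lambda>n::int. norm q ^ (nat \<bar>n\<bar> - 1)) summable_on (range (\<lambda>n. - int n) - range int)"
      by (rule summable_on_subset[OF _ Diff_subset])
    ultimately show "(\<lambda>n::int. norm q ^ (nat \<bar>n\<bar> - 1)) summable_on UNIV"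
      unfolding U by (rule summable_on_Un_disjoint) (rule Diff_disjoint)
  qed
  show "eis_row q summable_on UNIV"
    by (rule abs_summable_summable, rule Infinite_Sum.abs_summable_on_comparison_test'[OF s]) (use b in auto)
  have "summable (\<lambda>n. q ^ n / (1 - q ^ Suc n)\<^sup>2)"
    by (rule summable_comparison_test'[OF summable_geometric_bound[of "norm q"]])
      (use q lambert_term_bound[of q "norm q"] in auto)
  then have "(\<lambda>n. q ^ n / (1 - q ^ Suc n)\<^sup>2) sums (- eisenstein2s q / 24)"
    by (simp add: eisenstein2s_def summable_sums)
  \<comment> \<open>The rows -1, -2, ... give half of the nonconstant part. By evenness the rows 1,
    2, ... give the other half, and the row 0 adds pi^2/3.\<close>
  from sums_mult[OF this, of "- 4 * (of_real pi)\<^sup>2 * q"]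
  have S: "(\<lambda>n. eis_row q (- int n - 1)) sums ((of_real pi)\<^sup>2 / 6 * (q * eisenstein2s q))"
  proof (rule back_subst[of "\<lambda>f. f sums _", OF back_subst[of "\<lambda>x. _ sums x"]])
    show "(\<lambda>n. - 4 * (of_real pi)\<^sup>2 * q * (q ^ n / (1 - q ^ Suc n)\<^sup>2)) = (\<lambda>n. eis_row q (- int n - 1))"
    proof
      fix n
      have "nat \<bar>- int n - 1\<bar> = Suc n" by simp
      then show "- 4 * (of_real pi)\<^sup>2 * q * (q ^ n / (1 - q ^ Suc n)\<^sup>2) = eis_row q (- int n - 1)"
        unfolding eis_row_def by simp
    qed
  qed (simp add: field_simps)
  moreover have "(\<lambda>n. eis_row q (int n)) sums ((of_real pi)\<^sup>2 / 6 * (q * eisenstein2s q) + (of_real pi)\<^sup>2 / 3)"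
  proof -
    have "eis_row q (int (Suc n)) = eis_row q (- int n - 1)" for n
    proof -
      have "- int n - 1 = - int (Suc n)" by simp
      then show ?thesis by (simp only: eis_row_minus)
    qed
    with S have "(\<lambda>n. eis_row q (int (Suc n))) sums ((of_real pi)\<^sup>2 / 6 * (q * eisenstein2s q))"
      by (simp only:)
    from sums_Suc[OF this] show ?thesis by (simp add: eis_row_def)
  qed
  ultimately have "(\<lambda>n. eis_row q (int n) + eis_row q (- int n - 1)) sums
     ((of_real pi)\<^sup>2 / 6 * (q * eisenstein2s q) + (of_real pi)\<^sup>2 / 3 + (of_real pi)\<^sup>2 / 6 * (q * eisenstein2s q))"
    by (intro sums_add)
  then show "(\<lambda>N. \<Sum>n<N. eis_row q (int n) + eis_row q (- int n - 1)) \<longlonglongrightarrow> (of_real pi)\<^sup>2 / 3 * eisenstein2 q"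
    unfolding sums_def by (simp add: eisenstein2_def algebra_simps add_divide_distrib)
qed

lemma eis_row_has_sum:
  assumes z: "Im z > 0" and s: "(\<lambda>m::int. 1 / (of_int m + of_int n * z)\<^sup>2) summable_on UNIV"
  shows "((\<lambda>m::int. 1 / (of_int m + of_int n * z)\<^sup>2) has_sum eis_row (qvar z) n) UNIV"
proof (cases "n = 0")
  case True
  have a: "(\<lambda>n. 1 / (of_nat (Suc n))\<^sup>2 :: complex) sums ((of_real pi)\<^sup>2 / 6)"
    using sums_of_real[OF inverse_squares_sums, where ?'a = complex] by simp
  then have b: "(\<lambda>n. 1 / (of_nat n)\<^sup>2 :: complex) sums ((of_real pi)\<^sup>2 / 6)"
    using sums_Suc[of "\<lambda>n. 1 / (of_nat n)\<^sup>2 :: complex"] by simp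
  have "(\<lambda>n. 1 / (of_nat n)\<^sup>2 + 1 / (of_nat (Suc n))\<^sup>2 :: complex) sums ((of_real pi)\<^sup>2 / 6 + (of_real pi)\<^sup>2 / 6)"
    by (rule sums_add[OF b a])
  moreover have "(of_int (- int k - 1))\<^sup>2 = (of_nat (Suc k) :: complex)\<^sup>2" for k
  proof -
    have "of_int (- int k - 1) = - (of_nat (Suc k) :: complex)" by simp
    then show ?thesis by (simp only: power2_minus)
  qed
  ultimately have "(\<lambda>N. \<Sum>k<N. 1 / (of_int (int k) + of_int n * z)\<^sup>2 + 1 / (of_int (- int k - 1) + of_int n * z)\<^sup>2)
     \<longlonglongrightarrow> (of_real pi)\<^sup>2 / 6 + (of_real pi)\<^sup>2 / 6"
    unfolding sums_def True by (simp only: of_int_0 mult_zero_left add_0_right of_int_of_nat_eq)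
  then have "(\<lambda>N. \<Sum>k<N. 1 / (of_int (int k) + of_int n * z)\<^sup>2 + 1 / (of_int (- int k - 1) + of_int n * z)\<^sup>2)
     \<longlonglongrightarrow> eis_row (qvar z) n"
    by (simp add: True eis_row_def)
  with s show ?thesis by (rule has_sum_intI)
next
  case False
  define w where "w = of_int n * z"
  have "Im w \<noteq> 0" using False z by (simp add: w_def)
  then have w: "w \<notin> \<int>" using complex_is_Int_iff by blast
  define k where "k = nat \<bar>n\<bar>"
  have k: "k > 0" using False by (simp add: k_def)
  \<comment> \<open>The squared sine is even, so a negative n may be replaced by |n|, which keeps
    the exponent of q positive.\<close>
  have wk: "w = of_nat k * z \<or> w = - (of_nat k * z)"
    by (cases "n \<ge> 0") (auto simp: w_def k_def)
  have "(sin (of_real pi * w))\<^sup>2 = (sin (of_real pi * (of_nat k * z)))\<^sup>2"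
    using wk by auto
  also have "\<dots> = - (1 - qvar z ^ k)\<^sup>2 / (4 * qvar z ^ k)"
    by (simp only: sin_squared_qvar qvar_of_nat_mult)
  finally have "(of_real pi)\<^sup>2 / (sin (of_real pi * w))\<^sup>2 = eis_row (qvar z) n"
    using False by (simp add: eis_row_def k_def)
  with sin_squared_LIMSEQ[OF w] have
    "(\<lambda>N. \<Sum>k<N. 1 / (of_int (int k) + w)\<^sup>2 + 1 / (of_int (- int k - 1) + w)\<^sup>2) \<longlonglongrightarrow> eis_row (qvar z) n"
    by simp
  with s show ?thesis unfolding w_def by (rule has_sum_intI)
qed

section \<open>Lattice estimates and majorants\<close>

lemma lattice_norm_bound:
  assumes z: "Im z > 0"
  obtains \<delta> where "\<delta> > 0" "\<And>s t. \<delta> * (s\<^sup>2 + t\<^sup>2) \<le> (norm (of_real s + of_real t * z))\<^sup>2"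
proof -
  \<comment> \<open>The imaginary part of w = s + t z controls t, and s is then recovered from s = w
    - t z; K adds up the two squared constants.\<close>
  define K where "K = (1 + norm z / Im z)\<^sup>2 + (1 / Im z)\<^sup>2"
  have K: "K > 0" unfolding K_def using z by (intro add_nonneg_pos) auto
  have "s\<^sup>2 + t\<^sup>2 \<le> K * (norm (of_real s + of_real t * z))\<^sup>2" for s t :: real
  proof -
    define w where "w = of_real s + of_real t * z"
    have "Im w = t * Im z" by (simp add: w_def)
    then have "\<bar>t\<bar> * Im z \<le> norm w" using abs_Im_le_cmod[of w] z by (simp add: abs_mult)
    then have t: "\<bar>t\<bar> \<le> norm w / Im z" using z by (simp add: field_simps)
    have "norm (of_real s :: complex) = norm (w - of_real t * z)" by (simp add: w_def)
    also have "\<dots> \<le> norm w + \<bar>t\<bar> * norm z"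
      using norm_triangle_ineq4[of w "of_real t * z"] by (simp add: norm_mult)
    also have "\<dots> \<le> norm w + norm w / Im z * norm z"
      using t by (intro add_left_mono mult_right_mono) auto
    also have "\<dots> = norm w * (1 + norm z / Im z)" by (simp add: algebra_simps)
    finally have "\<bar>s\<bar> \<le> norm w * (1 + norm z / Im z)" by simp
    then have "\<bar>s\<bar>\<^sup>2 \<le> (norm w * (1 + norm z / Im z))\<^sup>2" by (intro power_mono) auto
    moreover have "\<bar>t\<bar>\<^sup>2 \<le> (norm w / Im z)\<^sup>2" using t by (intro power_mono) auto
    ultimately have "s\<^sup>2 + t\<^sup>2 \<le> (norm w * (1 + norm z / Im z))\<^sup>2 + (norm w / Im z)\<^sup>2" by simp
    also have "\<dots> = K * (norm w)\<^sup>2"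
      by (simp only: K_def power_mult_distrib power_divide) (simp add: ring_distribs)
    finally show ?thesis unfolding w_def [symmetric] .
  qed
  then have "1 / K * (s\<^sup>2 + t\<^sup>2) \<le> (norm (of_real s + of_real t * z))\<^sup>2" for s t :: real
    using K by (simp add: field_simps)
  moreover have "1 / K > 0" using K by simp
  ultimately show ?thesis by (rule that[rotated])
qed

text \<open>Eight times the difference of the two sides is (7m - 1)(m - 1) + 7n^2, and no integer
  lies strictly between 1/7 and 1; the second bound follows with -m for m. Together with the lattice
  estimate this keeps w - 1/2 and w + 1/2 away from 0 at every lattice point, the origin
  included.\<close>

lemma int_shift_bound: "(1 + (of_int m)\<^sup>2 + (of_int n)\<^sup>2) / 8 \<le> (of_int m - 1/2)\<^sup>2 + (of_int n :: real)\<^sup>2"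
  and int_shift_bound': "(1 + (of_int m)\<^sup>2 + (of_int n)\<^sup>2) / 8 \<le> (of_int m + 1/2)\<^sup>2 + (of_int n :: real)\<^sup>2"
proof -
  have *: "(7 * m - 1) * (m - 1) \<ge> 0" for m :: int
    by (cases "m \<ge> 1") (auto intro: mult_nonneg_nonneg mult_nonpos_nonpos)
  have **: "(7 * of_int m - 1) * (of_int m - 1) \<ge> (0::real)" for m :: int
    using of_int_le_iff[of 0 "(7 * m - 1) * (m - 1)", where ?'a = real] * by simp
  show "(1 + (of_int m)\<^sup>2 + (of_int n)\<^sup>2) / 8 \<le> (of_int m - 1/2)\<^sup>2 + (of_int n :: real)\<^sup>2"
  proof -
    have "(of_int m - 1/2)\<^sup>2 + (of_int n)\<^sup>2 - (1 + (of_int m)\<^sup>2 + (of_int n)\<^sup>2) / 8 =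
        ((7 * of_int m - 1) * (of_int m - 1) + 7 * (of_int n)\<^sup>2) / (8::real)"
      by (simp add: field_simps power2_eq_square)
    moreover have "\<dots> \<ge> 0" using **[of m] by simp
    ultimately show ?thesis by linarith
  qed
  show "(1 + (of_int m)\<^sup>2 + (of_int n)\<^sup>2) / 8 \<le> (of_int m + 1/2)\<^sup>2 + (of_int n :: real)\<^sup>2"
  proof -
    have "(of_int m + 1/2)\<^sup>2 + (of_int n)\<^sup>2 - (1 + (of_int m)\<^sup>2 + (of_int n)\<^sup>2) / 8 =
        ((7 * of_int (-m) - 1) * (of_int (-m) - 1) + 7 * (of_int n)\<^sup>2) / (8::real)"
      by (simp add: field_simps power2_eq_square)
    moreover have "\<dots> \<ge> 0" using **[of "-m"] by (intro divide_nonneg_nonneg add_nonneg_nonneg) auto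
    ultimately show ?thesis by linarith
  qed
qed

lemma summable_on_int_majorant:
  fixes f :: "int \<Rightarrow> complex"
  assumes "\<And>m. norm (f m) \<le> C / (1 + (of_int m)\<^sup>2)"
  shows "f summable_on UNIV"
proof -
  have "(\<lambda>m::int. C * (1 / (1 + (of_int m)\<^sup>2))) summable_on UNIV"
    by (intro summable_on_cmult_right summable_on_inverse_squares_int)
  then have "(\<lambda>m. norm (f m)) summable_on UNIV"
    by (rule Infinite_Sum.abs_summable_on_comparison_test') (use assms in auto)
  then show ?thesis by (rule abs_summable_summable)
qed

text \<open>The majorant is a product, so its iterated sum factors into two convergent
  one-dimensional sums.\<close>

lemma summable_on_int_int_majorant:
  fixes f :: "int \<times> int \<Rightarrow> complex"
  assumes "\<And>m n. norm (f (m, n)) \<le> C / ((1 + (of_int m)\<^sup>2) * (1 + (of_int n)\<^sup>2))"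
  shows "f summable_on UNIV"
proof -
  define g where "g = (\<lambda>m::int. 1 / (1 + (of_int m)\<^sup>2) :: real)"
  have g: "g summable_on UNIV" unfolding g_def by (rule summable_on_inverse_squares_int)
  have pos: "g m \<ge> 0" for m by (simp add: g_def add_nonneg_nonneg)
  define h where "h = (\<lambda>p. g (fst p) * g (snd p))"
  have h: "norm (h (m, n)) = g m * g n" for m n
    using pos by (simp add: h_def)
  have "(\<lambda>p. norm (h p)) summable_on (UNIV \<times> UNIV)"
    unfolding Infinite_Sum.abs_summable_on_Sigma_iff h
  proof (intro conjI ballI)
    show "(\<lambda>n. g m * g n) summable_on UNIV" for m
      by (rule summable_on_cmult_right[OF g])
    have "norm (\<Sum>\<^sub>\<infinity>n. g m * g n) = g m * (\<Sum>\<^sub>\<infinity>n. g n)" for m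
    proof -
      have "(\<Sum>\<^sub>\<infinity>n. g m * g n) = g m * (\<Sum>\<^sub>\<infinity>n. g n)"
        using g by (intro infsum_cmult_right) auto
      moreover have "(\<Sum>\<^sub>\<infinity>n. g n) \<ge> 0" by (rule infsum_nonneg) (use pos in auto)
      ultimately show ?thesis using pos by simp
    qed
    then show "(\<lambda>m. norm (\<Sum>\<^sub>\<infinity>n. g m * g n)) summable_on UNIV"
      using summable_on_cmult_left[OF g, of "\<Sum>\<^sub>\<infinity>n. g n"] by (simp only:)
  qed
  then have "h summable_on UNIV"
    unfolding UNIV_Times_UNIV by (rule abs_summable_summable)
  then have "(\<lambda>p. C * h p) summable_on UNIV"
    by (rule summable_on_cmult_right)
  moreover have "norm (f p) \<le> C * h p" for p
    using assms by (cases p) (simp add: h_def g_def)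
  ultimately have "(\<lambda>p. norm (f p)) summable_on UNIV"
    by (rule Infinite_Sum.abs_summable_on_comparison_test')
  then show ?thesis by (rule abs_summable_summable)
qed

section \<open>The quasimodularity of the weight 2 Eisenstein series\<close>

lemma has_sum_sum_lessThan:
  fixes f :: "nat \<Rightarrow> 'b \<Rightarrow> 'a::topological_comm_monoid_add"
  assumes "\<And>i. ((f i) has_sum s i) A"
  shows "((\<lambda>x. \<Sum>i<N. f i x) has_sum (\<Sum>i<N. s i)) A"
  by (induction N) (auto intro!: has_sum_add assms)

lemma has_sum_diff:
  fixes f g :: "'b \<Rightarrow> 'a::real_normed_algebra_1"
  assumes "(f has_sum a) A" "(g has_sum b) A"
  shows "((\<lambda>x. f x - g x) has_sum (a - b)) A"
  using has_sum_add[OF assms(1) has_sum_cmult_right[OF assms(2), of "- 1"]] by simp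

lemma sum_telescope_int:
  fixes f :: "int \<Rightarrow> 'a::ab_group_add"
  shows "(\<Sum>k<N. (f (int k) - f (int k + 1)) + (f (- int k - 1) - f (- int k - 1 + 1))) = f (- int N) - f (int N)"
proof (induction N)
  case 0
  then show ?case by simp
next
  case (Suc N)
  have e1: "int N + 1 = int (Suc N)" and e2: "- int N - 1 = - int (Suc N)" and e3: "- int (Suc N) + 1 = - int N"
    by simp_all
  have gen: "(a - b) + ((b - c) + (d - a)) = d - c" for a b c d :: 'a
    by (simp add: algebra_simps)
  show ?case
    by (simp only: sum.lessThan_Suc Suc e1 e2 e3 gen)
qed

text \<open>Written with exp(-2ix), which tends to 0 as Im x tends to minus infinity, the direction
  needed next. At a pole both sides are 0 by division by zero.\<close>

lemma cot_exp: "cot x = \<i> * (1 + exp (- 2 * \<i> * x)) / (1 - exp (- 2 * \<i> * x))"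
proof -
  define u where "u = exp (\<i> * x)"
  define v where "v = exp (- 2 * \<i> * x)"
  have "exp (- (\<i> * x)) = u * v"
    by (simp add: u_def v_def exp_add [symmetric] algebra_simps)
  then have c: "cos x = u * (1 + v) / 2" and s: "sin x = u * (1 - v) / (2 * \<i>)"
    by (simp_all add: cos_exp_eq sin_exp_eq u_def algebra_simps)
  have "u \<noteq> 0" by (simp add: u_def)
  then show ?thesis
    unfolding v_def [symmetric] cot_def c s by (cases "v = 1") (simp_all add: field_simps)
qed

lemma Im_minus_inverse: "Im (- 1 / z) = Im z / (norm z)\<^sup>2"
  by (simp add: Im_divide cmod_power2)

lemma Im_minus_inverse_pos: "Im z > 0 \<Longrightarrow> Im (- 1 / z) > 0"
  by (metis Im_minus_inverse divide_pos_pos less_irrefl norm_zero zero_complex.sel(2) zero_less_norm_iff zero_less_power)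

text \<open>The exponential in the cotangent formula is a constant times the N-th power of
  \<open>qvar (- 1 / z)\<close>, a number of norm less than 1.\<close>

lemma cot_tendsto_i:
  assumes z: "Im z > 0"
  shows "(\<lambda>N. cot (of_real pi * ((of_nat N + c) / z))) \<longlonglongrightarrow> \<i>"
proof -
  define A where "A = exp (- 2 * \<i> * (of_real pi * (c / z)))"
  have e: "exp (- 2 * \<i> * (of_real pi * ((of_nat N + c) / z))) = A * qvar (- 1 / z) ^ N" for N
  proof -
    have "- 2 * \<i> * (of_real pi * ((of_nat N + c) / z)) =
        - 2 * \<i> * (of_real pi * (c / z)) + 2 * of_real pi * \<i> * (of_nat N * (- 1 / z))"
      by (simp add: algebra_simps add_divide_distrib)
    moreover have "qvar (- 1 / z) ^ N = exp (2 * of_real pi * \<i> * (of_nat N * (- 1 / z)))"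
      unfolding qvar_of_nat_mult [symmetric] unfolding qvar_def ..
    ultimately show ?thesis
      by (simp only: exp_add A_def)
  qed
  have "(\<lambda>N. A * qvar (- 1 / z) ^ N) \<longlonglongrightarrow> A * 0"
    using norm_qvar_less_1[OF Im_minus_inverse_pos[OF z]]
    by (intro tendsto_mult tendsto_const LIMSEQ_power_zero) auto
  then have "(\<lambda>N. \<i> * (1 + A * qvar (- 1 / z) ^ N) / (1 - A * qvar (- 1 / z) ^ N)) \<longlonglongrightarrow> \<i> * (1 + 0) / (1 - 0)"
    by (intro tendsto_intros) auto
  then show ?thesis unfolding cot_exp e by simp
qed

lemma tendsto_inverse_nat_shift: "(\<lambda>N. 1 / (of_nat N + c :: complex)) \<longlonglongrightarrow> 0"
  by (rule tendsto_divide_0[OF tendsto_const])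
     (subst add.commute, rule tendsto_add_filterlim_at_infinity[OF tendsto_const tendsto_of_nat])

text \<open>The two orders of summation of the double series over 1/(m + n z)^2 give
  \<open>E\<^sub>2\<close> at z and at -1/z. Subtracting the telescoping terms b makes the double
  series absolutely convergent, so for the difference both orders agree. The correction term is the
  discrepancy between the two iterated sums of b.\<close>

lemma eisenstein2_inversion:
  assumes z: "Im z > 0"
  shows "eisenstein2 (qvar (- 1 / z)) = z\<^sup>2 * eisenstein2 (qvar z) - 6 * \<i> * z / of_real pi"
proof -
  have z0: "z \<noteq> 0" using z by auto
  have z': "Im (- 1 / z) > 0" by (rule Im_minus_inverse_pos[OF z])
  define w where "w = (\<lambda>(m::int) (n::int). of_int m + of_int n * z)"
  define t where "t = (\<lambda>m n. 1 / (w m n)\<^sup>2)"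
  \<comment> \<open>The shift by 1/2 keeps the denominator nonzero on the whole lattice, and b =
    1/(w - 1/2) - 1/(w + 1/2) telescopes in m.\<close>
  define b where "b = (\<lambda>m n. 1 / ((w m n)\<^sup>2 - 1/4))"
  define D where "D = (\<lambda>(m::int) (n::int). 1 + (of_int m)\<^sup>2 + (of_int n)\<^sup>2 :: real)"
  obtain \<delta> where \<delta>: "\<delta> > 0" "\<And>s t. \<delta> * (s\<^sup>2 + t\<^sup>2) \<le> (norm (of_real s + of_real t * z))\<^sup>2"
    using lattice_norm_bound[OF z] by blast
  have D1: "D m n \<ge> 1" for m n by (simp add: D_def)
  define C where "C = 8 / \<delta>"
  have C: "C > 0" using \<delta> by (simp add: C_def)
  have w0: "w m n = 0 \<longleftrightarrow> m = 0 \<and> n = 0" for m n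
  proof
    assume "w m n = 0"
    then have "\<delta> * ((of_int m)\<^sup>2 + (of_int n)\<^sup>2) \<le> 0"
      using \<delta>(2)[of "of_int m" "of_int n"] by (simp add: w_def)
    then have "(of_int m)\<^sup>2 + (of_int n)\<^sup>2 \<le> (0::real)"
      using \<delta>(1) by (meson linorder_not_less mult_pos_pos)
    then show "m = 0 \<and> n = 0"
      by (simp add: sum_power2_le_zero_iff)
  qed (simp add: w_def)
  have tb: "norm (t m n) \<le> C / D m n" for m n
  proof (cases "m = 0 \<and> n = 0")
    case True
    then show ?thesis using w0[of m n] C D1[of m n] by (simp add: t_def)
  next
    case False
    have "(of_int m)\<^sup>2 + (of_int n)\<^sup>2 \<ge> (1::real)"
    proof -
      have "m\<^sup>2 + n\<^sup>2 > 0" using False by (simp add: sum_power2_gt_zero_iff)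
      then have "1 \<le> m\<^sup>2 + n\<^sup>2" by linarith
      then have "(of_int 1::real) \<le> of_int (m\<^sup>2 + n\<^sup>2)" by (simp only: of_int_le_iff)
      then show ?thesis by simp
    qed
    then have "D m n \<le> 8 * ((of_int m)\<^sup>2 + (of_int n)\<^sup>2)" by (simp add: D_def)
    then have "\<delta> * (D m n / 8) \<le> \<delta> * ((of_int m)\<^sup>2 + (of_int n)\<^sup>2)"
      using \<delta>(1) by (intro mult_left_mono) auto
    also have "\<dots> \<le> (norm (w m n))\<^sup>2"
      using \<delta>(2)[of "of_int m" "of_int n"] by (simp add: w_def)
    finally have *: "\<delta> * D m n / 8 \<le> (norm (w m n))\<^sup>2" by simp
    have "norm (t m n) = 1 / (norm (w m n))\<^sup>2" by (simp add: t_def norm_divide norm_power)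
    also have "\<dots> \<le> 1 / (\<delta> * D m n / 8)"
      using \<delta>(1) D1[of m n] by (intro frac_le *) auto
    finally show ?thesis by (simp add: C_def)
  qed
  have split: "(w m n)\<^sup>2 - 1/4 = (w m n - 1/2) * (w m n + 1/2)" for m n
    by (simp add: algebra_simps power2_eq_square)
  have half: "\<delta> * D m n / 8 \<le> (norm (w m n - 1/2))\<^sup>2" "\<delta> * D m n / 8 \<le> (norm (w m n + 1/2))\<^sup>2" for m n
  proof -
    have "\<delta> * (D m n / 8) \<le> \<delta> * ((of_int m - 1/2)\<^sup>2 + (of_int n)\<^sup>2)"
      using int_shift_bound[of m n] \<delta>(1) by (intro mult_left_mono) (auto simp: D_def)
    also have "\<dots> \<le> (norm (w m n - 1/2))\<^sup>2"
      using \<delta>(2)[of "of_int m - 1/2" "of_int n"] by (simp add: w_def algebra_simps)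
    finally show "\<delta> * D m n / 8 \<le> (norm (w m n - 1/2))\<^sup>2" by simp
    have "\<delta> * (D m n / 8) \<le> \<delta> * ((of_int m + 1/2)\<^sup>2 + (of_int n)\<^sup>2)"
      using int_shift_bound'[of m n] \<delta>(1) by (intro mult_left_mono) (auto simp: D_def)
    also have "\<dots> \<le> (norm (w m n + 1/2))\<^sup>2"
      using \<delta>(2)[of "of_int m + 1/2" "of_int n"] by (simp add: w_def algebra_simps)
    finally show "\<delta> * D m n / 8 \<le> (norm (w m n + 1/2))\<^sup>2" by simp
  qed
  have pos: "\<delta> * D m n / 8 > 0" for m n using \<delta>(1) D1[of m n] by simp
  have nz: "w m n - 1/2 \<noteq> 0" "w m n + 1/2 \<noteq> 0" for m n
    using half[of m n] pos[of m n] by (auto simp: not_le[symmetric] simp del: right_minus_eq)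
  have bb: "norm (b m n) \<le> C / D m n" for m n
  proof -
    have "(\<delta> * D m n / 8)\<^sup>2 \<le> (norm (w m n - 1/2))\<^sup>2 * (norm (w m n + 1/2))\<^sup>2"
      unfolding power2_eq_square[of "\<delta> * D m n / 8"] using half[of m n] pos[of m n] by (intro mult_mono) auto
    also have "\<dots> = (norm ((w m n)\<^sup>2 - 1/4))\<^sup>2"
      by (simp only: split norm_mult power_mult_distrib)
    finally have *: "\<delta> * D m n / 8 \<le> norm ((w m n)\<^sup>2 - 1/4)"
      by (rule power2_le_imp_le) simp
    have "norm (b m n) = 1 / norm ((w m n)\<^sup>2 - 1/4)" by (simp add: b_def norm_divide)
    also have "\<dots> \<le> 1 / (\<delta> * D m n / 8)"
      using pos[of m n] by (intro frac_le *) auto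
    finally show ?thesis by (simp add: C_def)
  qed
  \<comment> \<open>At the origin t is 1/0 = 0 and b is -4, which explains the summand 4. Elsewhere
    t - b = -tb/4 is bounded by C^2/D^2, and D^2 dominates (1 + m^2)(1 + n^2).\<close>
  have db: "norm (t m n - b m n) \<le> (4 + C\<^sup>2) / ((1 + (of_int m)\<^sup>2) * (1 + (of_int n)\<^sup>2))" for m n
  proof (cases "m = 0 \<and> n = 0")
    case True
    then show ?thesis using w0[of m n] by (simp add: t_def b_def)
  next
    case False
    have "1 / W - 1 / X = - (1/4) * (1 / W * (1 / X))" if "W \<noteq> 0" "X \<noteq> 0" "X = W - 1/4" for W X :: complex
      using that(1,2) by (simp add: diff_frac_eq that(3))
    moreover have "(w m n)\<^sup>2 \<noteq> 0" "(w m n)\<^sup>2 - 1/4 \<noteq> 0"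
      using False w0[of m n] nz[of m n] unfolding split[of m n] by (simp_all only: mult_eq_0_iff power2_eq_square simp_thms)
    ultimately have "t m n - b m n = - (1/4) * (t m n * b m n)"
      unfolding t_def b_def by blast
    then have "norm (t m n - b m n) = 1/4 * (norm (t m n) * norm (b m n))"
      by (simp add: norm_mult)
    also have "\<dots> \<le> 1 * (C / D m n * (C / D m n))"
      using tb[of m n] bb[of m n] C D1[of m n] by (intro mult_mono) auto
    also have "\<dots> = C\<^sup>2 / (D m n)\<^sup>2" by (simp add: power2_eq_square)
    also have "\<dots> \<le> (4 + C\<^sup>2) / ((1 + (of_int m)\<^sup>2) * (1 + (of_int n)\<^sup>2))"
    proof (rule frac_le)
      have "(1 + (of_int m)\<^sup>2) * (1 + (of_int n)\<^sup>2) \<le> D m n * D m n"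
        by (rule mult_mono) (auto simp: D_def)
      then show "(1 + (of_int m)\<^sup>2) * (1 + (of_int n)\<^sup>2) \<le> (D m n)\<^sup>2" by (simp add: power2_eq_square)
    qed (auto intro!: mult_pos_pos add_pos_nonneg)
    finally show ?thesis .
  qed
  have Dm: "C / D m n \<le> C / (1 + (of_int m)\<^sup>2)" "C / D m n \<le> C / (1 + (of_int n)\<^sup>2)" for m n
    using C by (intro frac_le; auto simp: D_def intro: add_pos_nonneg)+
  have st: "(\<lambda>m. t m n) summable_on UNIV" "(\<lambda>n. t m n) summable_on UNIV"
    and sb: "(\<lambda>m. b m n) summable_on UNIV" "(\<lambda>n. b m n) summable_on UNIV" for m n
    using order_trans[OF tb Dm(1)] order_trans[OF tb Dm(2)] order_trans[OF bb Dm(1)] order_trans[OF bb Dm(2)]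
    by (blast intro: summable_on_int_majorant)+
  have R1: "((\<lambda>m. t m n) has_sum eis_row (qvar z) n) UNIV" for n
    using eis_row_has_sum[OF z, of n] st(1)[of n] by (simp add: t_def w_def)
  have b_eq: "b m n = 1 / (w m n - 1/2) - 1 / (w (m + 1) n - 1/2)" for m n
  proof -
    have "w (m + 1) n - 1/2 = w m n + 1/2" by (simp add: w_def)
    then show ?thesis unfolding b_def split[of m n] using diff_frac_eq[OF nz[of m n], of 1 1] by (simp add: add.commute)
  qed
  have b_sum: "(\<Sum>k<N. b (int k) n + b (- int k - 1) n) = 1 / (w (- int N) n - 1/2) - 1 / (w (int N) n - 1/2)" for n N
    unfolding b_eq by (rule sum_telescope_int)
  \<comment> \<open>Summed over m first, b contributes nothing, so this order still gives
    \<open>E\<^sub>2\<close> at z.\<close>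
  have R2: "((\<lambda>m. b m n) has_sum 0) UNIV" for n
  proof (rule has_sum_intI[OF sb(1)])
    have "(\<lambda>N. - (1 / (of_nat N + (1/2 - of_int n * z))) - 1 / (of_nat N + (of_int n * z - 1/2))) \<longlonglongrightarrow> - 0 - 0"
      by (intro tendsto_diff tendsto_minus tendsto_inverse_nat_shift)
    moreover have "1 / (w (- int N) n - 1/2) = - (1 / (of_nat N + (1/2 - of_int n * z)))" for N
    proof -
      have "w (- int N) n - 1/2 = - (of_nat N + (1/2 - of_int n * z))" by (simp add: w_def)
      then show ?thesis by (simp only: minus_divide_right)
    qed
    moreover have "w (int N) n - 1/2 = of_nat N + (of_int n * z - 1/2)" for N
      by (simp add: w_def)
    ultimately show "(\<lambda>N. \<Sum>k<N. b (int k) n + b (- int k - 1) n) \<longlonglongrightarrow> 0"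
      by (simp only: b_sum) simp
  qed
  \<comment> \<open>From m + n z = z (n + (-m)(-1/z)): the columns of the lattice of z are rows of
    the lattice of -1/z, up to the factor 1/z^2.\<close>
  have R3: "((\<lambda>n. t m n) has_sum (1 / z\<^sup>2 * eis_row (qvar (- 1 / z)) m)) UNIV" for m
  proof -
    have e: "1 / (of_int n + of_int (- m) * (- 1 / z))\<^sup>2 = z\<^sup>2 * t m n" for n
    proof -
      have "of_int n + of_int (- m) * (- 1 / z) = w m n / z"
        using z0 by (simp add: w_def field_simps)
      then show ?thesis using z0 by (simp add: t_def power_divide)
    qed
    have "(\<lambda>n. z\<^sup>2 * t m n) summable_on UNIV"
      by (rule summable_on_cmult_right[OF st(2)])
    then have "((\<lambda>n. z\<^sup>2 * t m n) has_sum eis_row (qvar (- 1 / z)) (- m)) UNIV"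
      using eis_row_has_sum[OF z', of "- m"] unfolding e by blast
    from has_sum_cmult_right[OF this, of "1 / z\<^sup>2"] show ?thesis
      using z0 by (simp add: eis_row_minus)
  qed
  define B where "B = (\<lambda>m. \<Sum>\<^sub>\<infinity>n. b m n)"
  have R4: "((\<lambda>n. b m n) has_sum B m) UNIV" for m
    unfolding B_def by (rule has_sum_infsum[OF sb(2)])
  define d where "d = (\<lambda>p. t (fst p) (snd p) - b (fst p) (snd p))"
  define S where "S = infsum d UNIV"
  have "d summable_on UNIV"
    by (rule summable_on_int_int_majorant[of _ "4 + C\<^sup>2"]) (use db in \<open>simp add: d_def\<close>)
  then have S: "(d has_sum S) (UNIV \<times> UNIV)"
    by (simp add: S_def)
  have "((\<lambda>m. 1 / z\<^sup>2 * eis_row (qvar (- 1 / z)) m - B m) has_sum S) UNIV"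
    by (rule has_sum_SigmaD[OF S]) (use has_sum_diff[OF R3 R4] in \<open>simp add: d_def\<close>)
  from has_sum_diff[OF has_sum_cmult_right[OF eis_rows_has_sum[OF norm_qvar_less_1[OF z']], of "1 / z\<^sup>2"] this]
  have BS: "(B has_sum (1 / z\<^sup>2 * ((of_real pi)\<^sup>2 / 3 * eisenstein2 (qvar (- 1 / z))) - S)) UNIV"
    by simp
  have S': "((\<lambda>(n,m). d (m,n)) has_sum S) (UNIV \<times> UNIV)"
    using S by (subst (asm) has_sum_swap)
  have "((\<lambda>n. eis_row (qvar z) n - 0) has_sum S) UNIV"
    by (rule has_sum_SigmaD[OF S']) (use has_sum_diff[OF R1 R2] in \<open>simp add: d_def\<close>)
  then have S_eq: "S = (of_real pi)\<^sup>2 / 3 * eisenstein2 (qvar z)"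
    using eis_rows_has_sum[OF norm_qvar_less_1[OF z]] has_sum_unique by fastforce
  \<comment> \<open>Over a finite window of m the sums over n may be added first. Telescoping in m
    leaves two boundary terms, whose sums over n are cotangent series.\<close>
  have B_sum: "(\<Sum>k<N. B (int k) + B (- int k - 1)) =
      1 / z * (- (of_real pi * cot (of_real pi * ((of_nat N + 1/2) / z))) - of_real pi * cot (of_real pi * ((of_nat N + (- 1/2)) / z)))" for N
  proof -
    define x1 where "x1 = (of_nat N + 1/2) / z"
    define x2 where "x2 = (of_nat N + (- 1/2)) / z"
    \<comment> \<open>A nonzero real number divided by the non-real z is not real, so N + 1/2 and N
      - 1/2 never lead to a pole of the cotangent.\<close>
    have nonint: "of_real s / z \<notin> \<int>" if "s \<noteq> 0" for s :: real
    proof -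
      have "Im (of_real s / z) = - s * Im (- 1 / z)" by (simp add: Im_divide)
      then have "Im (of_real s / z) \<noteq> 0" using that z' by auto
      then show ?thesis using complex_is_Int_iff by blast
    qed
    have "real N + 1/2 \<noteq> 0" by linarith
    from nonint[OF this] have x1: "- x1 \<notin> \<int>" by (simp add: x1_def)
    have "2 * N \<noteq> 1" by presburger
    then have "real (2 * N) \<noteq> real 1" by (simp only: of_nat_eq_iff simp_thms)
    then have "real N + (- 1/2) \<noteq> 0" by simp
    from nonint[OF this] have x2: "x2 \<notin> \<int>" by (simp add: x2_def)
    define f where "f = (\<lambda>n. 1 / (w (- int N) n - 1/2) - 1 / (w (int N) n - 1/2))"
    have f_eq: "f n = 1 / z * (1 / (of_int n + - x1) - 1 / (of_int n + x2))" for n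
    proof -
      have "w (- int N) n - 1/2 = z * (of_int n + - x1)" "w (int N) n - 1/2 = z * (of_int n + x2)"
        using z0 by (simp_all add: w_def x1_def x2_def field_simps)
      then show ?thesis by (simp add: f_def algebra_simps)
    qed
    have "((\<lambda>n. \<Sum>k<N. b (int k) n + b (- int k - 1) n) has_sum (\<Sum>k<N. B (int k) + B (- int k - 1))) UNIV"
      by (intro has_sum_sum_lessThan has_sum_add R4)
    then have "(f has_sum (\<Sum>k<N. B (int k) + B (- int k - 1))) UNIV"
      by (simp only: b_sum f_def)
    then have "(\<lambda>K. \<Sum>n<K. f (int n) + f (- int n - 1)) \<longlonglongrightarrow> (\<Sum>k<N. B (int k) + B (- int k - 1))"
      by (rule has_sum_int_LIMSEQ)
    moreover have "(\<Sum>n<K. f (int n) + f (- int n - 1)) =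
       1 / z * ((\<Sum>n<K. 1 / (of_int (int n) + - x1) + 1 / (of_int (- int n - 1) + - x1)) -
                (\<Sum>n<K. 1 / (of_int (int n) + x2) + 1 / (of_int (- int n - 1) + x2)))" for K
      unfolding f_eq sum_subtractf [symmetric] sum_distrib_left
      by (rule sum.cong) (simp_all add: algebra_simps)
    moreover have "(\<lambda>K. 1 / z * ((\<Sum>n<K. 1 / (of_int (int n) + - x1) + 1 / (of_int (- int n - 1) + - x1)) -
                (\<Sum>n<K. 1 / (of_int (int n) + x2) + 1 / (of_int (- int n - 1) + x2))))
       \<longlonglongrightarrow> 1 / z * (of_real pi * cot (of_real pi * (- x1)) - of_real pi * cot (of_real pi * x2))"
      by (intro tendsto_mult tendsto_const tendsto_diff cot_LIMSEQ x1 x2)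
    ultimately have "(\<Sum>k<N. B (int k) + B (- int k - 1)) =
       1 / z * (of_real pi * cot (of_real pi * (- x1)) - of_real pi * cot (of_real pi * x2))"
      by (simp only:) (rule LIMSEQ_unique)
    moreover have "cot (of_real pi * (- x1)) = - cot (of_real pi * x1)"
      by (simp only: mult_minus_right cot_minus)
    ultimately show ?thesis unfolding x1_def [symmetric] x2_def [symmetric] by simp
  qed
  \<comment> \<open>Both cotangents tend to i, so the column sums of b add up to -2 pi i / z,
    against 0 for the row sums. This is the whole nonmodular term.\<close>
  have "(\<lambda>N. \<Sum>k<N. B (int k) + B (- int k - 1)) \<longlonglongrightarrow>
      1 / z * (- (of_real pi * \<i>) - of_real pi * \<i>)"
    unfolding B_sum by (intro tendsto_mult tendsto_const tendsto_diff tendsto_minus cot_tendsto_i z)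
  with has_sum_int_LIMSEQ[OF BS] have
    "1 / z\<^sup>2 * ((of_real pi)\<^sup>2 / 3 * eisenstein2 (qvar (- 1 / z))) - S = 1 / z * (- (of_real pi * \<i>) - of_real pi * \<i>)"
    by (rule LIMSEQ_unique)
  then have "1 / z\<^sup>2 * ((of_real pi)\<^sup>2 / 3 * eisenstein2 (qvar (- 1 / z))) =
      (of_real pi)\<^sup>2 / 3 * eisenstein2 (qvar z) - 2 * of_real pi * \<i> / z"
    unfolding S_eq by (simp add: algebra_simps)
  then have "z\<^sup>2 * 3 / (of_real pi)\<^sup>2 * (1 / z\<^sup>2 * ((of_real pi)\<^sup>2 / 3 * eisenstein2 (qvar (- 1 / z)))) =
      z\<^sup>2 * 3 / (of_real pi)\<^sup>2 * ((of_real pi)\<^sup>2 / 3 * eisenstein2 (qvar z) - 2 * of_real pi * \<i> / z)"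
    by (rule arg_cong)
  also have "z\<^sup>2 * 3 / (of_real pi)\<^sup>2 * ((of_real pi)\<^sup>2 / 3 * eisenstein2 (qvar z) - 2 * of_real pi * \<i> / z) =
      z\<^sup>2 * eisenstein2 (qvar z) - 6 * \<i> * z / of_real pi"
    using z0 by (simp add: field_simps power2_eq_square)
  finally show ?thesis using z0 by simp
qed

section \<open>The discriminant and the Eisenstein series of weights 4 and 6\<close>

lemma qvar_in_ball: "Im z > 0 \<Longrightarrow> qvar z \<in> ball 0 1"
  using norm_qvar_less_1 by simp

lemma qvar_has_field_derivative:
  "(qvar has_field_derivative 2 * of_real pi * \<i> * qvar z) (at z)"
  unfolding qvar_def [abs_def] by (auto intro!: derivative_eq_intros)

lemma compose_qvar_has_field_derivative:
  assumes f: "f holomorphic_on ball 0 1" and z: "Im z > 0"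
  shows "((\<lambda>z. f (qvar z)) has_field_derivative 2 * of_real pi * \<i> * (qvar z * deriv f (qvar z))) (at z)"
proof -
  have "(f has_field_derivative deriv f (qvar z)) (at (qvar z))"
    using f z by (intro holomorphic_derivI[of _ "ball 0 1"]) (auto intro: norm_qvar_less_1)
  from DERIV_chain2[OF this qvar_has_field_derivative] show ?thesis
    by (simp add: algebra_simps)
qed

lemma open_upper_half_plane: "open upper_half_plane"
  unfolding upper_half_plane_def by (rule open_halfspace_Im_gt)

lemma compose_qvar_holomorphic:
  "f holomorphic_on ball 0 1 \<Longrightarrow> (\<lambda>z. f (qvar z)) holomorphic_on upper_half_plane"
  unfolding holomorphic_on_open[OF open_upper_half_plane]
  by (auto simp: upper_half_plane_def dest: compose_qvar_has_field_derivative)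

lemma minus_inverse_has_field_derivative:
  "z \<noteq> 0 \<Longrightarrow> ((\<lambda>z. - 1 / z) has_field_derivative 1 / z\<^sup>2) (at z)" for z :: complex
  by (auto intro!: derivative_eq_intros simp: power2_eq_square)

text \<open>The chain rule applied to both sides of a law under z -> -1/z; it converts the law of f
  into one for q f'.\<close>

lemma compose_qvar_inversion_derivative:
  assumes f: "f holomorphic_on ball 0 1"
    and eq: "\<And>z. Im z > 0 \<Longrightarrow> f (qvar (- 1 / z)) = R z"
    and R: "(R has_field_derivative R') (at z)" and z: "Im z > 0"
  shows "2 * of_real pi * \<i> * (qvar (- 1 / z) * deriv f (qvar (- 1 / z))) = z\<^sup>2 * R'"
proof -
  have z0: "z \<noteq> 0" using z by auto
  have "((\<lambda>z. f (qvar (- 1 / z))) has_field_derivative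
      2 * of_real pi * \<i> * (qvar (- 1 / z) * deriv f (qvar (- 1 / z))) * (1 / z\<^sup>2)) (at z)"
    by (rule DERIV_chain2[OF compose_qvar_has_field_derivative[OF f Im_minus_inverse_pos[OF z]]
          minus_inverse_has_field_derivative[OF z0]])
  moreover have "((\<lambda>z. f (qvar (- 1 / z))) has_field_derivative R') (at z)"
    by (rule has_field_derivative_transform_within_open[OF R open_upper_half_plane])
      (use z eq in \<open>auto simp: upper_half_plane_def\<close>)
  ultimately have "2 * of_real pi * \<i> * (qvar (- 1 / z) * deriv f (qvar (- 1 / z))) * (1 / z\<^sup>2) = R'"
    by (rule DERIV_unique)
  then show ?thesis using z0 by (auto simp: field_simps)
qed

text \<open>Ramanujan's differential equations, read as definitions of \<open>E\<^sub>4\<close> and \<open>E\<^sub>6\<close>.\<close>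

definition eisenstein4 :: "complex \<Rightarrow> complex" where
  "eisenstein4 q = (eisenstein2 q)\<^sup>2 - 12 * (q * deriv eisenstein2 q)"

definition eisenstein6 :: "complex \<Rightarrow> complex" where
  "eisenstein6 q = eisenstein2 q * eisenstein4 q - 3 * (q * deriv eisenstein4 q)"

lemma eisenstein4_holomorphic [holomorphic_intros]: "eisenstein4 holomorphic_on ball 0 1"
  unfolding eisenstein4_def [abs_def] by (intro holomorphic_intros) auto

lemma eisenstein6_holomorphic [holomorphic_intros]: "eisenstein6 holomorphic_on ball 0 1"
  unfolding eisenstein6_def [abs_def] by (intro holomorphic_intros) auto

text \<open>The law of \<open>E\<^sub>2\<close> has the extra term c z. Squaring it produces 2c z^3
  E + c^2 z^2; since 2 pi i c = 12, the term 12 q \<open>E\<^sub>2\<close>' produces exactly the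
  same surplus, and the two cancel.\<close>

lemma eisenstein4_inversion:
  assumes z: "Im z > 0"
  shows "eisenstein4 (qvar (- 1 / z)) = z ^ 4 * eisenstein4 (qvar z)"
proof -
  define c where "c = - 6 * \<i> / of_real pi"
  define E where "E = eisenstein2 (qvar z)"
  define X where "X = qvar z * deriv eisenstein2 (qvar z)"
  have cp: "c * (2 * of_real pi * \<i>) = 12" by (simp add: c_def)
  have E: "eisenstein2 (qvar (- 1 / z)) = z\<^sup>2 * eisenstein2 (qvar z) + c * z" if "Im z > 0" for z
    using eisenstein2_inversion[OF that] by (simp add: c_def)
  have "((\<lambda>z. z\<^sup>2 * eisenstein2 (qvar z) + c * z) has_field_derivative
      2 * z * E + z\<^sup>2 * (2 * of_real pi * \<i> * X) + c) (at z)"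
    unfolding E_def X_def
    by (rule derivative_eq_intros refl compose_qvar_has_field_derivative[OF eisenstein2_holomorphic z])+ simp
  from compose_qvar_inversion_derivative[OF eisenstein2_holomorphic E this z]
  have *: "2 * of_real pi * \<i> * (qvar (- 1 / z) * deriv eisenstein2 (qvar (- 1 / z))) =
      z\<^sup>2 * (2 * z * E + z\<^sup>2 * (2 * of_real pi * \<i> * X) + c)" .
  have "12 * (qvar (- 1 / z) * deriv eisenstein2 (qvar (- 1 / z))) =
      c * (2 * of_real pi * \<i> * (qvar (- 1 / z) * deriv eisenstein2 (qvar (- 1 / z))))"
    by (simp only: cp [symmetric] mult.assoc)
  also have "\<dots> = 2 * c * z ^ 3 * E + z ^ 4 * (c * (2 * of_real pi * \<i>)) * X + c\<^sup>2 * z\<^sup>2"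
    unfolding * by (simp only: power2_eq_square power3_eq_cube power4_eq_xxxx) (simp add: algebra_simps)
  finally show ?thesis
    unfolding eisenstein4_def E[OF z] cp E_def [symmetric] X_def [symmetric]
    by (simp only: power2_eq_square power3_eq_cube power4_eq_xxxx) (simp add: algebra_simps)
qed

text \<open>The same cancellation one step up: \<open>E\<^sub>2 E\<^sub>4\<close> and 3 q
  \<open>E\<^sub>4\<close>' both carry the surplus c z^5 \<open>E\<^sub>4\<close>.\<close>

lemma eisenstein6_inversion:
  assumes z: "Im z > 0"
  shows "eisenstein6 (qvar (- 1 / z)) = z ^ 6 * eisenstein6 (qvar z)"
proof -
  define c where "c = - 6 * \<i> / of_real pi"
  define E where "E = eisenstein4 (qvar z)"
  define X where "X = qvar z * deriv eisenstein4 (qvar z)"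
  have cp: "c / 4 * (2 * of_real pi * \<i>) = 3" by (simp add: c_def)
  have E2: "eisenstein2 (qvar (- 1 / z)) = z\<^sup>2 * eisenstein2 (qvar z) + c * z"
    using eisenstein2_inversion[OF z] by (simp add: c_def)
  have "((\<lambda>z. z ^ 4 * eisenstein4 (qvar z)) has_field_derivative
      4 * z ^ 3 * E + z ^ 4 * (2 * of_real pi * \<i> * X)) (at z)"
    unfolding E_def X_def
    by (rule derivative_eq_intros refl compose_qvar_has_field_derivative[OF eisenstein4_holomorphic z])+ simp
  from compose_qvar_inversion_derivative[OF eisenstein4_holomorphic eisenstein4_inversion this z]
  have *: "2 * of_real pi * \<i> * (qvar (- 1 / z) * deriv eisenstein4 (qvar (- 1 / z))) =
      z\<^sup>2 * (4 * z ^ 3 * E + z ^ 4 * (2 * of_real pi * \<i> * X))" .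
  have "3 * (qvar (- 1 / z) * deriv eisenstein4 (qvar (- 1 / z))) =
      c / 4 * (2 * of_real pi * \<i> * (qvar (- 1 / z) * deriv eisenstein4 (qvar (- 1 / z))))"
    by (simp only: cp [symmetric] mult.assoc)
  also have "\<dots> = c * z ^ 5 * E + z ^ 6 * (c / 4 * (2 * of_real pi * \<i>)) * X"
    unfolding * by (simp add: algebra_simps power_numeral_reduce)
  finally show ?thesis
    unfolding eisenstein6_def E2 cp E_def [symmetric] X_def [symmetric] eisenstein4_inversion[OF z]
    by (simp add: algebra_simps power_numeral_reduce)
qed

lemma eisenstein_at_0: "eisenstein2 0 = 1" "eisenstein4 0 = 1" "eisenstein6 0 = 1"
  by (simp_all add: eisenstein2_def eisenstein4_def eisenstein6_def)

text \<open>The differential equations propagate the coefficient -24 of \<open>E\<^sub>2\<close> to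
  240 and -504. These values determine 1728 = 3 * 240 + 2 * 504 in the discriminant
  identity.\<close>

lemma eisenstein_deriv_at_0:
  shows "(eisenstein4 has_field_derivative 240) (at 0)" "(eisenstein6 has_field_derivative - 504) (at 0)"
proof -
  have d: "(f has_field_derivative deriv f 0) (at 0)" if "f holomorphic_on ball 0 1" for f :: "complex \<Rightarrow> complex"
    using that by (intro holomorphic_derivI[of _ "ball 0 1"]) auto
  have dd: "((\<lambda>q. q * deriv f q) has_field_derivative deriv f 0) (at 0)" if "f holomorphic_on ball 0 1" for f :: "complex \<Rightarrow> complex"
  proof -
    have "(deriv f has_field_derivative deriv (deriv f) 0) (at 0)"
      using that by (intro d holomorphic_deriv) auto
    then show ?thesis by (auto intro!: derivative_eq_intros)
  qed
  have "(eisenstein2 has_field_derivative - 24) (at 0)"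
    unfolding eisenstein2_def [abs_def]
    by (rule derivative_eq_intros refl d[OF eisenstein2s_holomorphic])+ (simp add: eisenstein2s_0)
  note e2 = this DERIV_imp_deriv[OF this]
  show e4: "(eisenstein4 has_field_derivative 240) (at 0)"
    unfolding eisenstein4_def [abs_def]
    by (rule derivative_eq_intros refl e2(1) dd[OF eisenstein2_holomorphic])+ (simp add: e2 eisenstein_at_0)
  show "(eisenstein6 has_field_derivative - 504) (at 0)"
    unfolding eisenstein6_def [abs_def]
    by (rule derivative_eq_intros refl e2(1) e4 dd[OF eisenstein4_holomorphic])+
      (simp add: DERIV_imp_deriv[OF e4] eisenstein_at_0)
qed

section \<open>The discriminant function\<close>

definition delta_log :: "complex \<Rightarrow> complex" where
  "delta_log = (SOME S. S 0 = 0 \<and> (\<forall>q\<in>ball 0 1. (S has_field_derivative eisenstein2s q) (at q)))"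

lemma delta_log: "delta_log 0 = 0" "q \<in> ball 0 1 \<Longrightarrow> (delta_log has_field_derivative eisenstein2s q) (at q)"
proof -
  obtain S where S: "\<And>q. q \<in> ball 0 1 \<Longrightarrow> (S has_field_derivative eisenstein2s q) (at q within ball 0 1)"
    using holomorphic_convex_primitive'[OF convex_ball open_ball eisenstein2s_holomorphic] by blast
  have S': "((\<lambda>q. S q - S 0) has_field_derivative eisenstein2s q) (at q)" if "q \<in> ball 0 1" for q
    using S[OF that] that by (auto intro!: derivative_eq_intros simp: at_within_open[OF that open_ball])
  have "\<exists>S. S 0 = 0 \<and> (\<forall>q\<in>ball 0 1. (S has_field_derivative eisenstein2s q) (at q))"
    by (rule exI[of _ "\<lambda>q. S q - S 0"]) (use S' in auto)
  from someI_ex[OF this] show "delta_log 0 = 0"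
    "q \<in> ball 0 1 \<Longrightarrow> (delta_log has_field_derivative eisenstein2s q) (at q)"
    by (simp_all add: delta_log_def [symmetric])
qed

lemma delta_log_holomorphic [holomorphic_intros]: "delta_log holomorphic_on ball 0 1"
  unfolding holomorphic_on_open[OF open_ball] using delta_log(2) by blast

text \<open>\<open>delta_log\<close> is a primitive of (\<open>E\<^sub>2\<close> - 1)/q, hence a
  logarithm of the product of all (1 - q^n)^24. In this form q = 0 is visibly the only zero, and the
  logarithmic derivative is \<open>E\<^sub>2\<close>/q.\<close>

definition delta :: "complex \<Rightarrow> complex" where
  "delta q = q * exp (delta_log q)"

lemma delta_holomorphic [holomorphic_intros]: "delta holomorphic_on ball 0 1"
  unfolding delta_def [abs_def] by (intro holomorphic_intros)

lemma delta_eq_0_iff [simp]: "delta q = 0 \<longleftrightarrow> q = 0"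
  by (simp add: delta_def)

lemma delta_deriv: "q \<in> ball 0 1 \<Longrightarrow> q * deriv delta q = eisenstein2 q * delta q"
proof -
  assume q: "q \<in> ball 0 1"
  have "(delta has_field_derivative exp (delta_log q) + q * (exp (delta_log q) * eisenstein2s q)) (at q)"
    unfolding delta_def [abs_def] by (rule derivative_eq_intros refl delta_log(2)[OF q])+ simp
  from DERIV_imp_deriv[OF this] show ?thesis
    by (simp add: delta_def eisenstein2_def algebra_simps)
qed

text \<open>The logarithmic derivatives of both sides agree: the extra term in the law of
  \<open>E\<^sub>2\<close> yields 12/z. So the quotient is constant on the convex half-plane, and at
  the fixed point i it is 1 because i^12 = 1.\<close>

lemma delta_inversion:
  assumes z: "Im z > 0"
  shows "delta (qvar (- 1 / z)) = z ^ 12 * delta (qvar z)"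
proof -
  define h where "h = (\<lambda>z. delta (qvar (- 1 / z)) / (z ^ 12 * delta (qvar z)))"
  have "(h has_field_derivative 0) (at z)" if z: "Im z > 0" for z
  proof -
    have z0: "z \<noteq> 0" using z by auto
    note z' = Im_minus_inverse_pos[OF z]
    define A where "A = delta (qvar (- 1 / z))"
    define B where "B = delta (qvar z)"
    define E where "E = eisenstein2 (qvar z)"
    have B: "B \<noteq> 0" by (simp add: B_def)
    have dA: "((\<lambda>z. delta (qvar (- 1 / z))) has_field_derivative
      2 * of_real pi * \<i> * (eisenstein2 (qvar (- 1 / z)) * A) * (1 / z\<^sup>2)) (at z)"
      unfolding A_def delta_deriv[OF qvar_in_ball[OF z'], symmetric]
      by (rule DERIV_chain2[OF compose_qvar_has_field_derivative[OF delta_holomorphic z']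
          minus_inverse_has_field_derivative[OF z0]])
    have "2 * of_real pi * \<i> * (eisenstein2 (qvar (- 1 / z)) * A) * (1 / z\<^sup>2) = (2 * of_real pi * \<i> * E + 12 / z) * A"
      unfolding eisenstein2_inversion[OF z] E_def using z0
      by (simp add: field_simps power2_eq_square)
    note dA = dA[unfolded this]
    have dB: "((\<lambda>z. delta (qvar z)) has_field_derivative 2 * of_real pi * \<i> * (E * B)) (at z)"
      unfolding E_def B_def delta_deriv[OF qvar_in_ball[OF z], symmetric]
      by (rule compose_qvar_has_field_derivative[OF delta_holomorphic z])
    have dB': "((\<lambda>z. z ^ 12 * delta (qvar z)) has_field_derivative (2 * of_real pi * \<i> * E + 12 / z) * (z ^ 12 * B)) (at z)"
      by (rule derivative_eq_intros refl dB)+ (use z0 in \<open>simp add: B_def [symmetric] field_simps power_numeral_reduce\<close>)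
    have "(h has_field_derivative
        ((2 * of_real pi * \<i> * E + 12 / z) * A * (z ^ 12 * B) - A * ((2 * of_real pi * \<i> * E + 12 / z) * (z ^ 12 * B)))
         / ((z ^ 12 * B) * (z ^ 12 * B))) (at z)"
      unfolding h_def A_def B_def by (rule DERIV_divide[OF dA[unfolded A_def B_def] dB'[unfolded A_def B_def]]) (use z0 in simp)
    then show ?thesis by (simp add: algebra_simps)
  qed
  then have "(h has_field_derivative 0) (at z within upper_half_plane)" if "z \<in> upper_half_plane" for z
    using that by (auto simp: upper_half_plane_def intro: has_field_derivative_at_within)
  moreover have "convex upper_half_plane"
    unfolding upper_half_plane_def by (rule convex_halfspace_Im_gt)
  ultimately obtain c where c: "\<And>z. z \<in> upper_half_plane \<Longrightarrow> h z = c"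
    using has_field_derivative_zero_constant[of upper_half_plane h] by blast
  have "- 1 / \<i> = \<i>" by (simp add: complex_eq_iff Re_divide Im_divide)
  then have "h \<i> = 1" by (simp add: h_def power_numeral_reduce)
  with c[of \<i>] c[of z] have "h z = 1" using z by (simp add: upper_half_plane_def)
  moreover have "z \<noteq> 0" using z by auto
  ultimately show ?thesis by (simp add: h_def field_simps)
qed

section \<open>Modular functions as polynomials in the modular invariant\<close>

definition modular_function :: "(complex \<Rightarrow> complex) \<Rightarrow> bool" where
  "modular_function h \<longleftrightarrow> h holomorphic_on upper_half_plane \<and>
     (\<forall>z. Im z > 0 \<longrightarrow> h (z + 1) = h z) \<and> (\<forall>z. Im z > 0 \<longrightarrow> h (- 1 / z) = h z)"

section \<open>Orbits, lifts to the q-disc and the maximum principle\<close>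

lemma periodic_of_int:
  assumes T: "\<And>z. Im z > 0 \<Longrightarrow> h (z + 1) = h z" and z: "Im z > 0"
  shows "h (z + of_int n) = h z"
proof -
  have nat: "h (z + of_nat k) = h z" if "Im z > 0" for k z
  proof (induction k)
    case (Suc k)
    have "h (z + of_nat k + 1) = h (z + of_nat k)" using that by (intro T) simp
    moreover have "z + of_nat (Suc k) = z + of_nat k + 1" by simp
    ultimately show ?case using Suc by (simp only:)
  qed simp
  show ?thesis
  proof (cases "n \<ge> 0")
    case True
    then show ?thesis using nat[OF z, of "nat n"] by simp
  next
    case False
    then show ?thesis using nat[of "z + of_int n" "nat (- n)"] z by simp
  qed
qed

text \<open>After a translation to |Re| <= 1/2, a point with Im < 1/2 has squared norm at most 1/2,
  so inversion at least doubles its imaginary part; k bounds the number of doublings. This coarse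
  reduction already gives |q| <= exp(-pi).\<close>

lemma modular_orbit_Im_ge_half:
  assumes T: "\<And>z. Im z > 0 \<Longrightarrow> h (z + 1) = h z" and S: "\<And>z. Im z > 0 \<Longrightarrow> h (- 1 / z) = h z"
    and z: "Im z > 0"
  obtains z' where "Im z' \<ge> 1/2" "h z' = h z"
proof -
  have step: "\<exists>z'. Im z' \<ge> 1/2 \<and> h z' = h z" if "Im z > 0" "Im z * 2 ^ k \<ge> 1/2" for k z
    using that
  proof (induction k arbitrary: z)
    case 0
    then show ?case by auto
  next
    case (Suc k)
    define n where "n = - round (Re z)"
    define u where "u = z + of_int n"
    have u: "Im u = Im z" "\<bar>Re u\<bar> \<le> 1/2"
      using of_int_round_abs_le[of "Re z"] by (auto simp: u_def n_def abs_minus_commute)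
    have hu: "h u = h z" unfolding u_def by (rule periodic_of_int[of h, OF T]) (use Suc in auto)
    show ?case
    proof (cases "Im z \<ge> 1/2")
      case False
      have "(Re u)\<^sup>2 \<le> (1/2)\<^sup>2" using u(2) by (metis abs_ge_zero power2_abs power_mono)
      moreover have "(Im u)\<^sup>2 \<le> (1/2)\<^sup>2" using False Suc.prems u(1) by (intro power_mono) auto
      ultimately have "(Re u)\<^sup>2 + (Im u)\<^sup>2 \<le> (1/2)\<^sup>2 + (1/2)\<^sup>2" by (rule add_mono)
      then have n: "(norm u)\<^sup>2 \<le> 1/2" unfolding cmod_power2 by (simp add: power2_eq_square)
      have n0: "(norm u)\<^sup>2 > 0" using Suc.prems u(1) by auto
      have "Im u / (norm u)\<^sup>2 \<ge> Im u / (1/2)"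
        using Suc.prems u(1) n n0 by (intro divide_left_mono) auto
      then have "Im (- 1 / u) \<ge> 2 * Im z" unfolding Im_minus_inverse u(1) by simp
      moreover from this have "Im (- 1 / u) * 2 ^ k \<ge> 2 * Im z * 2 ^ k"
        by (intro mult_right_mono) auto
      ultimately have "\<exists>z'. Im z' \<ge> 1/2 \<and> h z' = h (- 1 / u)"
      proof (intro Suc.IH)
        show "Im (- 1 / u) > 0" by (rule Im_minus_inverse_pos) (use u Suc.prems in simp)
        have "1/2 \<le> 2 * Im z * 2 ^ k" using Suc.prems by simp
        also assume "2 * Im z * 2 ^ k \<le> Im (- 1 / u) * 2 ^ k"
        finally show "1/2 \<le> Im (- 1 / u) * 2 ^ k" .
      qed
      moreover have "h (- 1 / u) = h z" using S[of u] hu u Suc.prems by simp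
      ultimately show ?thesis by auto
    qed auto
  qed
  obtain k where "1 / (2 * Im z) < 2 ^ k" using real_arch_pow[of 2] by auto
  then have "Im z * 2 ^ k \<ge> 1/2" using z by (simp add: field_simps)
  from step[OF z this] show ?thesis using that by blast
qed

lemma qvar_surj:
  assumes "q \<noteq> 0" "norm q < 1"
  obtains z where "Im z > 0" "qvar z = q"
proof
  have i: "Ln q / (2 * of_real pi * \<i>) = (- \<i> * Ln q) / of_real (2 * pi)"
    by (simp add: field_simps)
  have "Im (Ln q / (2 * of_real pi * \<i>)) = - ln (norm q) / (2 * pi)"
    unfolding i Im_divide_of_real using assms(1) by simp
  then show "Im (Ln q / (2 * of_real pi * \<i>)) > 0"
    using assms by (simp add: divide_neg_pos)
  show "qvar (Ln q / (2 * of_real pi * \<i>)) = q"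
    using assms by (simp add: qvar_def)
qed

lemma norm_qvar_le_iff: "norm (qvar z) \<le> exp (- 2 * pi * y) \<longleftrightarrow> y \<le> Im z"
  by (simp add: norm_qvar)

lemma Im_pos_of_norm_qvar:
  assumes "norm (qvar z) < 1"
  shows "Im z > 0"
proof (rule ccontr)
  assume "\<not> Im z > 0"
  then have "- 2 * pi * Im z \<ge> 0" by (intro mult_nonpos_nonpos) auto
  then have "norm (qvar z) \<ge> 1" unfolding norm_qvar by simp
  with assms show False by simp
qed

lemma qvar_eqD:
  assumes "qvar w = qvar z"
  obtains n where "w = z + of_int n"
proof -
  from assms obtain n where "2 * of_real pi * \<i> * w = 2 * of_real pi * \<i> * z + (of_int (2 * n) * of_real pi) * \<i>"
    unfolding qvar_def exp_eq by auto
  also have "\<dots> = 2 * of_real pi * \<i> * (z + of_int n)" by (simp add: algebra_simps)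
  finally have "w = z + of_int n"
    unfolding mult_cancel_left by (simp only: mult_eq_0_iff) simp
  then show ?thesis by (rule that)
qed

text \<open>A local inverse of \<^term>\<open>qvar\<close> near \<open>q0\<close> is \<open>z0 + Ln (q / q0) / (2 \<pi> \<i>)\<close>, so no branch cut
  ever matters.\<close>

lemma periodic_lift:
  assumes hol: "h holomorphic_on upper_half_plane" and T: "\<And>z. Im z > 0 \<Longrightarrow> h (z + 1) = h z"
    and B: "\<And>z. Im z \<ge> 1 \<Longrightarrow> norm (h z) \<le> B"
  obtains \<phi> where "\<phi> holomorphic_on ball 0 1" "\<And>z. Im z > 0 \<Longrightarrow> h z = \<phi> (qvar z)"
proof -
  define \<psi> where "\<psi> = (\<lambda>q. h (SOME z. Im z > 0 \<and> qvar z = q))"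
  have \<psi>: "\<psi> (qvar z) = h z" if z: "Im z > 0" for z
  proof -
    have "\<exists>w. Im w > 0 \<and> qvar w = qvar z" using z by blast
    from someI_ex[OF this] obtain n where "(SOME w. Im w > 0 \<and> qvar w = qvar z) = z + of_int n"
      using qvar_eqD by blast
    then show ?thesis using periodic_of_int[of h, OF T z, of n] by (simp add: \<psi>_def)
  qed
  have "\<psi> holomorphic_on ball 0 1 - {0}"
  proof -
    have op: "open (ball (0::complex) 1 - {0})" by (intro open_Diff) auto
    have "\<exists>D. (\<psi> has_field_derivative D) (at q0)" if q0: "q0 \<in> ball 0 1 - {0}" for q0
    proof -
      obtain z0 where z0: "Im z0 > 0" "qvar z0 = q0" using qvar_surj[of q0] q0 by auto
      define L where "L = (\<lambda>q. z0 + Ln (q / q0) / (2 * of_real pi * \<i>))"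
      have L: "qvar (L q) = q" if "q \<noteq> 0" for q
      proof -
        have "2 * of_real pi * \<i> * L q = 2 * of_real pi * \<i> * z0 + Ln (q / q0)"
          by (simp add: L_def distrib_left)
        then have "qvar (L q) = qvar z0 * exp (Ln (q / q0))"
          by (simp only: qvar_def exp_add)
        also have "\<dots> = q" using that q0 z0(2) by simp
        finally show ?thesis .
      qed
      have Im_L: "Im (L q) > 0" if "q \<in> ball 0 1 - {0}" for q
      proof -
        have "norm (qvar (L q)) < 1" using that L[of q] by simp
        then show ?thesis by (rule Im_pos_of_norm_qvar)
      qed
      have "(L has_field_derivative (1 / q0) / (2 * of_real pi * \<i>)) (at q0)"
        unfolding L_def
      proof -
        have "((\<lambda>q. Ln (q / q0)) has_field_derivative inverse (q0 / q0) * (1 / q0)) (at q0)"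
          by (rule DERIV_chain2[OF has_field_derivative_Ln]) (use q0 in \<open>auto intro!: derivative_eq_intros\<close>)
        moreover have "inverse (q0 / q0) * (1 / q0) = 1 / q0" using q0 by auto
        ultimately have "((\<lambda>q. Ln (q / q0)) has_field_derivative 1 / q0) (at q0)" by (simp only:)
        from DERIV_add[OF DERIV_const[of z0] DERIV_cdivide[OF this, of "2 * of_real pi * \<i>"]]
        show "((\<lambda>q. z0 + Ln (q / q0) / (2 * of_real pi * \<i>)) has_field_derivative (1 / q0) / (2 * of_real pi * \<i>)) (at q0)"
          by (simp only: add_0_left)
      qed
      moreover obtain D where "(h has_field_derivative D) (at (L q0))"
        using hol Im_L[OF q0] unfolding holomorphic_on_open[OF open_upper_half_plane]
        by (auto simp: upper_half_plane_def)
      ultimately have "((\<lambda>q. h (L q)) has_field_derivative D * ((1 / q0) / (2 * of_real pi * \<i>))) (at q0)"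
        by (rule DERIV_chain2[rotated])
      moreover have "h (L q) = \<psi> q" if "q \<in> ball 0 1 - {0}" for q
        using \<psi>[OF Im_L[OF that]] L that by simp
      ultimately have "(\<psi> has_field_derivative D * ((1 / q0) / (2 * of_real pi * \<i>))) (at q0)"
        using has_field_derivative_transform_within_open[OF _ _ q0, of "\<lambda>q. h (L q)" _ \<psi>] op by blast
      then show ?thesis by blast
    qed
    then show ?thesis unfolding holomorphic_on_open[OF op] by blast
  qed
  \<comment> \<open>Small nonzero q come from Im z >= 1, where h is bounded, so the singularity at q
    = 0 is removable.\<close>
  moreover have "eventually (\<lambda>q. norm (\<psi> q) \<le> B) (at 0)"
    unfolding eventually_at
  proof (intro exI[of _ "exp (- 2 * pi * 1)"] conjI ballI impI)
    fix q :: complex assume q: "q \<noteq> 0 \<and> dist q 0 < exp (- 2 * pi * 1)"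
    have e: "exp (- 2 * pi * 1) < (1::real)" by simp
    have nq: "norm q < exp (- 2 * pi * 1)" using q by (simp only: dist_norm diff_0_right)
    from nq e have "norm q < 1" by (rule less_trans)
    then obtain z where z: "Im z > 0" "qvar z = q" using qvar_surj q by blast
    have "1 \<le> Im z" unfolding norm_qvar_le_iff[symmetric] z(2) using nq by (rule less_imp_le)
    with B[OF this] \<psi>[OF z(1)] show "norm (\<psi> q) \<le> B" by (simp add: z(2))
  qed simp
  ultimately obtain \<phi> where "\<phi> holomorphic_on ball 0 1" "\<And>q. q \<in> ball 0 1 - {0} \<Longrightarrow> \<phi> q = \<psi> q"
    using holomorphic_on_extend_bounded[of \<psi> "ball 0 1" 0] by auto
  then show ?thesis using that[of \<phi>] \<psi> norm_qvar_less_1 by auto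
qed

lemma bounded_on_compact_disc:
  assumes "\<phi> holomorphic_on ball 0 1"
  obtains B where "\<And>q. norm q \<le> exp (- 2 * pi) \<Longrightarrow> norm (\<phi> q) \<le> B"
proof -
  have "exp (- 2 * pi) < (1::real)" by simp
  then have "continuous_on (cball 0 (exp (- 2 * pi))) \<phi>"
    by (intro holomorphic_on_imp_continuous_on holomorphic_on_subset[OF assms]) (simp add: cball_subset_ball_iff)
  then have "bounded (\<phi> ` cball 0 (exp (- 2 * pi)))"
    by (intro compact_imp_bounded compact_continuous_image) auto
  then obtain B where "\<And>q. q \<in> cball 0 (exp (- 2 * pi)) \<Longrightarrow> norm (\<phi> q) \<le> B"
    unfolding bounded_iff by blast
  then show ?thesis using that[of B] by (simp only: mem_cball_0)
qed

text \<open>Every orbit has a point with |q| <= exp(-pi), so the lifted function attains its maximum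
  modulus over the open unit disc on a compact subdisc.\<close>

lemma bounded_modular_function_constant:
  assumes h: "modular_function h" and B: "\<And>z. Im z \<ge> 1 \<Longrightarrow> norm (h z) \<le> B"
  obtains c where "\<And>z. Im z > 0 \<Longrightarrow> h z = c"
proof -
  from h have hol: "h holomorphic_on upper_half_plane" and T: "\<And>z. Im z > 0 \<Longrightarrow> h (z + 1) = h z"
    and S: "\<And>z. Im z > 0 \<Longrightarrow> h (- 1 / z) = h z"
    by (auto simp: modular_function_def)
  obtain \<phi> where \<phi>: "\<phi> holomorphic_on ball 0 1" "\<And>z. Im z > 0 \<Longrightarrow> h z = \<phi> (qvar z)"
    using periodic_lift[OF hol T B] by blast
  define r where "r = exp (- 2 * pi * (1/2))"
  have r: "0 < r" "r < 1" by (auto simp: r_def)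
  have "continuous_on (cball 0 r) \<phi>"
    by (intro holomorphic_on_imp_continuous_on holomorphic_on_subset[OF \<phi>(1)]) (use r in auto)
  then have "continuous_on (cball 0 r) (\<lambda>q. norm (\<phi> q))" by (intro continuous_intros)
  then obtain \<xi> where \<xi>: "\<xi> \<in> cball 0 r" "\<And>q. q \<in> cball 0 r \<Longrightarrow> norm (\<phi> q) \<le> norm (\<phi> \<xi>)"
    using continuous_attains_sup[of "cball 0 r" "\<lambda>q. norm (\<phi> q)"] r by auto
  have "norm (\<phi> q) \<le> norm (\<phi> \<xi>)" if q: "q \<in> ball 0 1" for q
  proof (cases "q = 0")
    case True
    then show ?thesis using \<xi>(2)[of 0] r by simp
  next
    case False
    then obtain z where z: "Im z > 0" "qvar z = q" using qvar_surj q by auto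
    obtain z' where z': "Im z' \<ge> 1/2" "h z' = h z" using modular_orbit_Im_ge_half[of h, OF T S z(1)] by blast
    then have "qvar z' \<in> cball 0 r" by (simp add: r_def norm_qvar)
    with \<xi>(2)[OF this] z z' \<phi>(2)[of z] \<phi>(2)[of z'] show ?thesis by simp
  qed
  then have "\<phi> constant_on ball 0 1"
    using \<xi>(1) r by (intro maximum_modulus_principle[OF \<phi>(1), of "ball 0 1" \<xi>]) auto
  then obtain c where "\<And>q. q \<in> ball 0 1 \<Longrightarrow> \<phi> q = c" unfolding constant_on_def by blast
  then show ?thesis using that[of c] \<phi>(2) norm_qvar_less_1 by auto
qed

section \<open>The modular invariant as a generator\<close>

definition klein_j :: "complex \<Rightarrow> complex" where
  "klein_j z = eisenstein4 (qvar z) ^ 3 / delta (qvar z)"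

lemma modular_function_klein_j: "modular_function klein_j"
  unfolding modular_function_def
proof (intro conjI allI impI)
  show "klein_j holomorphic_on upper_half_plane"
    unfolding klein_j_def [abs_def]
    by (intro holomorphic_on_divide holomorphic_on_power compose_qvar_holomorphic
        eisenstein4_holomorphic delta_holomorphic) simp
  fix z :: complex assume z: "Im z > 0"
  show "klein_j (z + 1) = klein_j z" by (simp add: klein_j_def qvar_add_1)
  have "z \<noteq> 0" using z by auto
  then show "klein_j (- 1 / z) = klein_j z"
    unfolding klein_j_def eisenstein4_inversion[OF z] delta_inversion[OF z]
    by (simp add: power_mult_distrib flip: power_mult)
qed

lemma modular_function_diff: "modular_function f \<Longrightarrow> modular_function g \<Longrightarrow> modular_function (\<lambda>z. f z - g z)"
  unfolding modular_function_def by (auto intro: holomorphic_intros)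

lemma modular_function_cmult: "modular_function f \<Longrightarrow> modular_function (\<lambda>z. c * f z)"
  unfolding modular_function_def by (auto intro: holomorphic_intros)

lemma modular_function_power: "modular_function f \<Longrightarrow> modular_function (\<lambda>z. f z ^ n)"
  unfolding modular_function_def by (auto intro: holomorphic_intros)

text \<open>Induction on the order of the pole at the cusp: subtracting a multiple of the matching
  power of j lowers it by one, and order 0 is the constant case.\<close>

lemma modular_function_poly_klein_j:
  assumes "modular_function h" "\<And>z. Im z \<ge> 1 \<Longrightarrow> norm (qvar z ^ N * h z) \<le> B"
  shows "\<exists>P. degree P \<le> N \<and> (\<forall>z. Im z > 0 \<longrightarrow> h z = poly P (klein_j z))"
  using assms
proof (induction N arbitrary: h B)
  case 0
  then obtain c where "\<And>z. Im z > 0 \<Longrightarrow> h z = c"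
    using bounded_modular_function_constant[of h B] by auto
  then show ?case by (intro exI[of _ "[:c:]"]) auto
next
  case (Suc N)
  define g where "g = (\<lambda>z. qvar z ^ Suc N * h z)"
  have "g holomorphic_on upper_half_plane"
    using Suc.prems(1) unfolding g_def modular_function_def
    by (intro holomorphic_intros compose_qvar_holomorphic[of "\<lambda>q. q"]) auto
  moreover have "g (z + 1) = g z" if "Im z > 0" for z
    using Suc.prems(1) that by (simp add: g_def modular_function_def qvar_add_1)
  moreover have "norm (g z) \<le> B" if "Im z \<ge> 1" for z
    using Suc.prems(2)[OF that] by (simp only: g_def)
  ultimately obtain \<phi> where \<phi>: "\<phi> holomorphic_on ball 0 1" "\<And>z. Im z > 0 \<Longrightarrow> g z = \<phi> (qvar z)"
    using periodic_lift by blast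
  \<comment> \<open>This is q j as a function of q, regular with value 1 at 0. Hence
    \<open>\<phi> 0\<close> is the coefficient that cancels the leading term.\<close>
  define \<omega> where "\<omega> = (\<lambda>q. eisenstein4 q ^ 3 / exp (delta_log q))"
  have \<omega>: "\<omega> holomorphic_on ball 0 1" "\<omega> 0 = 1"
    unfolding \<omega>_def by (intro holomorphic_intros) (auto simp: eisenstein_at_0 delta_log)
  have j: "klein_j z = \<omega> (qvar z) / qvar z" for z
    by (simp add: klein_j_def \<omega>_def delta_def)
  define \<theta> where "\<theta> = (\<lambda>q. \<phi> q - \<phi> 0 * \<omega> q ^ Suc N)"
  have "\<theta> holomorphic_on ball 0 1" unfolding \<theta>_def using \<phi>(1) \<omega>(1) by (intro holomorphic_intros)
  moreover have "\<theta> 0 = 0" by (simp add: \<theta>_def \<omega>(2))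
  ultimately obtain k where k: "k holomorphic_on ball 0 1" "\<And>q. norm q < 1 \<Longrightarrow> \<theta> q = q * k q"
    using Schwarz3 by metis
  obtain B' where B': "\<And>q. norm q \<le> exp (- 2 * pi) \<Longrightarrow> norm (k q) \<le> B'"
    using bounded_on_compact_disc[OF k(1)] by blast
  define h' where "h' = (\<lambda>z. h z - \<phi> 0 * klein_j z ^ Suc N)"
  have "modular_function h'"
    unfolding h'_def by (intro modular_function_diff modular_function_cmult modular_function_power
        modular_function_klein_j Suc.prems(1))
  moreover have "norm (qvar z ^ N * h' z) \<le> B'" if z: "Im z \<ge> 1" for z
  proof -
    have "qvar z * (qvar z ^ N * h' z) = \<theta> (qvar z)"
      using \<phi>(2)[of z] z unfolding \<theta>_def h'_def j g_def by (simp add: power_divide algebra_simps)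
    also have "\<dots> = qvar z * k (qvar z)"
      using z by (intro k(2) norm_qvar_less_1) simp
    finally have "qvar z ^ N * h' z = k (qvar z)" by simp
    then show ?thesis using B'[of "qvar z"] z by (simp add: norm_qvar)
  qed
  ultimately obtain P where P: "degree P \<le> N" "\<And>z. Im z > 0 \<Longrightarrow> h' z = poly P (klein_j z)"
    using Suc.IH by blast
  show ?case
  proof (intro exI[of _ "P + monom (\<phi> 0) (Suc N)"] conjI allI impI)
    show "degree (P + monom (\<phi> 0) (Suc N)) \<le> Suc N"
      using P(1) degree_monom_le[of "\<phi> 0" "Suc N"] by (intro degree_add_le) auto
    fix z assume "Im z > 0"
    then show "h z = poly (P + monom (\<phi> 0) (Suc N)) (klein_j z)"
      using P(2)[of z] by (simp add: h'_def poly_monom diff_eq_eq)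
  qed
qed

text \<open>The numerator vanishes at q = 0, so its quotient by Delta has weight 0 and is bounded at
  the cusp, hence constant. Its value at q = 0 is the derivative of the numerator there.\<close>

lemma eisenstein_discriminant:
  assumes "Im z > 0"
  shows "eisenstein4 (qvar z) ^ 3 - eisenstein6 (qvar z) ^ 2 = 1728 * delta (qvar z)"
proof -
  define f where "f = (\<lambda>q. eisenstein4 q ^ 3 - eisenstein6 q ^ 2)"
  have f: "f holomorphic_on ball 0 1" "f 0 = 0"
    unfolding f_def by (intro holomorphic_intros) (auto simp: eisenstein_at_0)
  have "(f has_field_derivative 3 * 240 - 2 * (- 504)) (at 0)"
    unfolding f_def by (rule derivative_eq_intros refl eisenstein_deriv_at_0)+ (simp add: eisenstein_at_0)
  then have d: "deriv f 0 = 1728" by (simp add: DERIV_imp_deriv)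
  obtain k where k: "k holomorphic_on ball 0 1" "\<And>q. norm q < 1 \<Longrightarrow> f q = q * k q" "k 0 = 1728"
    using Schwarz3[OF f] d by metis
  define \<kappa> where "\<kappa> = (\<lambda>q. k q / exp (delta_log q))"
  have \<kappa>: "\<kappa> holomorphic_on ball 0 1" "\<kappa> 0 = 1728"
    unfolding \<kappa>_def using k(1,3) by (auto intro!: holomorphic_intros simp: delta_log)
  define h where "h = (\<lambda>z. f (qvar z) / delta (qvar z))"
  have h_eq: "h z = \<kappa> (qvar z)" if "Im z > 0" for z
    using k(2)[OF norm_qvar_less_1[OF that]] by (simp add: h_def \<kappa>_def delta_def)
  have "modular_function h"
    unfolding modular_function_def
  proof (intro conjI allI impI)
    show "h holomorphic_on upper_half_plane"
      unfolding h_def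
      by (intro holomorphic_on_divide compose_qvar_holomorphic f delta_holomorphic) simp
    fix z :: complex assume z: "Im z > 0"
    show "h (z + 1) = h z" by (simp add: h_def qvar_add_1)
    have "z \<noteq> 0" using z by auto
    then show "h (- 1 / z) = h z"
      unfolding h_def f_def eisenstein4_inversion[OF z] eisenstein6_inversion[OF z] delta_inversion[OF z]
      by (simp add: power_mult_distrib right_diff_distrib [symmetric] flip: power_mult)
  qed
  moreover obtain B where "\<And>q. norm q \<le> exp (- 2 * pi) \<Longrightarrow> norm (\<kappa> q) \<le> B"
    using bounded_on_compact_disc[OF \<kappa>(1)] by blast
  then have "norm (h z) \<le> B" if "Im z \<ge> 1" for z
    using that h_eq[of z] by (simp add: norm_qvar)
  ultimately obtain c where c: "\<And>z. Im z > 0 \<Longrightarrow> h z = c"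
    using bounded_modular_function_constant by blast
  have \<kappa>c: "\<kappa> q = c" if "q \<in> ball 0 1 - {0}" for q
    using that qvar_surj[of q] c h_eq by auto
  have "eventually (\<lambda>q. \<kappa> q = c) (at 0)"
    unfolding eventually_at by (rule exI[of _ 1]) (use \<kappa>c in auto)
  then have "(\<kappa> \<longlongrightarrow> c) (at 0)" by (rule tendsto_eventually)
  moreover have "isCont \<kappa> 0"
    using holomorphic_on_imp_continuous_on[OF \<kappa>(1)] by (simp add: continuous_on_eq_continuous_at)
  then have "(\<kappa> \<longlongrightarrow> 1728) (at 0)" using \<kappa>(2) by (simp add: isCont_def)
  ultimately have "c = 1728" by (rule LIM_unique)
  then show ?thesis using c[OF assms] by (simp add: h_def f_def field_simps)
qed

section \<open>The elliptic points\<close>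

definition rho :: complex where
  "rho = Complex (- 1/2) (sqrt 3 / 2)"

lemma rho_cube: "rho ^ 3 = 1" "- 1 / rho = rho + 1" "Im rho > 0" "rho \<noteq> 1"
proof -
  have s: "sqrt 3 * sqrt 3 = (3::real)" by simp
  have r2: "rho * rho = - rho - 1"
    by (simp add: rho_def complex_eq_iff s)
  then have "rho * (rho + 1) = - 1" by (simp add: distrib_left)
  moreover show r0: "Im rho > 0" by (simp add: rho_def)
  then have "rho \<noteq> 0" by auto
  ultimately show "- 1 / rho = rho + 1" by (simp add: field_simps)
  have "rho * rho * rho = - (rho * rho) - rho" by (simp add: r2 algebra_simps)
  then show "rho ^ 3 = 1" by (simp add: power3_eq_cube r2)
  show "rho \<noteq> 1" by (simp add: rho_def complex_eq_iff)
qed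

text \<open>-1/rho = rho + 1 has the same nome as rho, so \<open>E\<^sub>4\<close> there equals
  rho^4 = rho times itself, with rho different from 1.\<close>

lemma eisenstein4_rho: "eisenstein4 (qvar rho) = 0"
proof -
  have "eisenstein4 (qvar rho) = rho ^ 4 * eisenstein4 (qvar rho)"
    using eisenstein4_inversion[OF rho_cube(3)] unfolding rho_cube(2) qvar_add_1 .
  moreover have "rho ^ 4 = rho" using rho_cube(1) by (simp add: power_numeral_reduce)
  ultimately show ?thesis using rho_cube(4)
    by (metis mult_cancel_right1 mult.commute)
qed

lemma minus_inverse_i: "- 1 / \<i> = \<i>"
  by (simp add: complex_eq_iff Re_divide Im_divide)

text \<open>The point i is fixed by inversion, and i^6 = -1.\<close>

lemma eisenstein6_i: "eisenstein6 (qvar \<i>) = 0"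
proof -
  have "eisenstein6 (qvar \<i>) = \<i> ^ 6 * eisenstein6 (qvar \<i>)"
    using eisenstein6_inversion[of \<i>] by (simp only: minus_inverse_i) simp
  then show ?thesis by (simp add: power_numeral_reduce)
qed

lemma klein_j_rho: "klein_j rho = 0"
  by (simp add: klein_j_def eisenstein4_rho)

lemma klein_j_i: "klein_j \<i> = 1728"
  using eisenstein_discriminant[of \<i>] by (simp add: klein_j_def eisenstein6_i)

section \<open>Taylor polynomials and local inverses\<close>

lemma higher_deriv_poly: "(deriv ^^ n) (poly p) = poly ((pderiv ^^ n) p)" for p :: "complex poly"
proof (induction n)
  case (Suc n)
  have "deriv (poly q) = poly (pderiv q)" for q :: "complex poly"
    by (rule ext) (rule DERIV_imp_deriv[OF poly_DERIV])
  then show ?case using Suc by simp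
qed simp

lemma poly_holomorphic: "poly p holomorphic_on A" for p :: "complex poly"
  unfolding holomorphic_on_def field_differentiable_def
  using poly_DERIV has_field_derivative_at_within by blast

lemma coeff_higher_pderiv_0: "coeff ((pderiv ^^ n) p) 0 = fact n * coeff p n" for p :: "complex poly"
proof (induction n arbitrary: p)
  case (Suc n)
  have "coeff ((pderiv ^^ Suc n) p) 0 = coeff ((pderiv ^^ n) (pderiv p)) 0"
    by (simp only: funpow_Suc_right o_apply)
  also have "\<dots> = fact n * coeff (pderiv p) n" by (rule Suc)
  finally show ?case by (simp add: coeff_pderiv algebra_simps)
qed simp

text \<open>\<open>p\<close> is the degree \<open>d\<close> Taylor polynomial of \<open>V\<close>, so Cauchy's estimates bound its coefficients.\<close>

lemma coeff_bound_of_taylor_poly: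
  fixes p :: "complex poly"
  assumes V: "V holomorphic_on ball 0 R" and r: "0 < r" "r < R"
    and M: "\<And>w. norm w \<le> r \<Longrightarrow> norm (V w) \<le> M"
    and s0: "s0 > 0" and B: "\<And>w. w \<noteq> 0 \<Longrightarrow> norm w < s0 \<Longrightarrow> norm (poly p w - V w) \<le> B * norm w ^ Suc d"
    and n: "n \<le> d"
  shows "norm (coeff p n) \<le> M / r ^ n"
proof -
  define H where "H = (\<lambda>w. poly p w - V w)"
  have H: "H holomorphic_on ball 0 R"
    unfolding H_def using V by (intro holomorphic_on_diff poly_holomorphic)
  \<comment> \<open>On a circle of radius s Cauchy's estimate gives order s^(d+1-n), at most s
    because n <= d; shrinking s then forces the derivative to vanish.\<close>
  have est: "norm ((deriv ^^ n) H 0) \<le> fact n * \<bar>B\<bar> * s" if s: "0 < s" "s < s0" "s < R" "s \<le> 1" for s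
  proof -
    have c: "norm ((deriv ^^ n) H 0) \<le> fact n * (\<bar>B\<bar> * s ^ Suc d) / s ^ n"
    proof (rule Cauchy_inequality)
      show "H holomorphic_on ball 0 s" by (rule holomorphic_on_subset[OF H]) (use s in auto)
      have "H holomorphic_on cball 0 s" by (rule holomorphic_on_subset[OF H]) (use s in auto)
      then show "continuous_on (cball 0 s) H" by (rule holomorphic_on_imp_continuous_on)
      fix x :: complex assume "norm (0 - x) = s"
      then have x: "norm x = s" by simp
      then have "x \<noteq> 0" using s by auto
      then have "norm (H x) \<le> B * norm x ^ Suc d" unfolding H_def by (rule B) (use s x in simp)
      also have "\<dots> \<le> \<bar>B\<bar> * s ^ Suc d" unfolding x using s by (intro mult_right_mono) auto
      finally show "norm (H x) \<le> \<bar>B\<bar> * s ^ Suc d" .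
    qed (use s in auto)
    have "s ^ Suc d \<le> s * s ^ n"
      using s n by (simp add: power_decreasing)
    then have "fact n * (\<bar>B\<bar> * s ^ Suc d) / s ^ n \<le> fact n * (\<bar>B\<bar> * (s * s ^ n)) / s ^ n"
      using s by (intro divide_right_mono mult_left_mono) auto
    also have "\<dots> = fact n * \<bar>B\<bar> * s" using s by simp
    finally have "fact n * (\<bar>B\<bar> * s ^ Suc d) / s ^ n \<le> fact n * \<bar>B\<bar> * s" .
    with c show ?thesis by (rule order_trans)
  qed
  have "(deriv ^^ n) H 0 = 0"
  proof (rule ccontr)
    assume "(deriv ^^ n) H 0 \<noteq> 0"
    then have pos: "norm ((deriv ^^ n) H 0) > 0" by simp
    define X where "X = norm ((deriv ^^ n) H 0)"
    define Y where "Y = fact n * \<bar>B\<bar>"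
    have Y: "Y \<ge> 0" by (simp add: Y_def)
    \<comment> \<open>Small enough for the estimate and for Y s < X; the summand 1 in Y + 1 covers
      the case Y = 0.\<close>
    define s where "s = Min {s0 / 2, R / 2, 1, X / (2 * (Y + 1))}"
    have X: "X > 0" using pos by (simp add: X_def)
    have "s > 0" using s0 r X Y by (simp add: s_def)
    moreover have le: "s \<le> s0 / 2" "s \<le> R / 2" "s \<le> 1" "s \<le> X / (2 * (Y + 1))"
      unfolding s_def by (rule Min_le; simp)+
    ultimately have "X \<le> Y * s"
      using est[of s] s0 r unfolding X_def Y_def by simp
    also have "\<dots> \<le> Y * (X / (2 * (Y + 1)))" using le(4) Y by (rule mult_left_mono)
    also have "\<dots> = X * (Y / (2 * (Y + 1)))" by simp
    also have "\<dots> < X * 1"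
      using X Y by (intro mult_strict_left_mono) auto
    finally show False by simp
  qed
  moreover have "(deriv ^^ n) H 0 = (deriv ^^ n) (poly p) 0 - (deriv ^^ n) V 0"
    unfolding H_def using V r by (intro higher_deriv_diff[of _ "ball 0 R"] poly_holomorphic) auto
  ultimately have eq: "(deriv ^^ n) V 0 = fact n * coeff p n"
    by (simp add: higher_deriv_poly poly_0_coeff_0 coeff_higher_pderiv_0)
  have "norm ((deriv ^^ n) V 0) \<le> fact n * M / r ^ n"
  proof (rule Cauchy_inequality)
    show "V holomorphic_on ball 0 r" by (rule holomorphic_on_subset[OF V]) (use r in auto)
    have "V holomorphic_on cball 0 r" by (rule holomorphic_on_subset[OF V]) (use r in auto)
    then show "continuous_on (cball 0 r) V" by (rule holomorphic_on_imp_continuous_on)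
  qed (use r M in auto)
  then have "fact n * norm (coeff p n) \<le> fact n * (M / r ^ n)"
    unfolding eq by (simp add: norm_mult)
  then show ?thesis by (simp only: mult_le_cancel_left_pos fact_gt_zero)
qed

lemma poly_sum_atMost:
  fixes p :: "'a::comm_semiring_1 poly"
  assumes "degree p \<le> d"
  shows "poly p x = (\<Sum>i\<le>d. coeff p i * x ^ i)"
  unfolding poly_altdef using assms
  by (intro sum.mono_neutral_left) (auto simp: coeff_eq_0)

text \<open>With x = |w|/r, Cauchy's bounds dominate the nonconstant part by M(x + x^2 + ...), and M
  x <= 1 - 2x makes this less than 1. The zero-free radius depends on M and r alone; B and
  \<open>s0\<close> only identify p as a Taylor polynomial.\<close>

lemma taylor_poly_nonzero:
  fixes p :: "complex poly"
  assumes V: "V holomorphic_on ball 0 R" "V 0 = 1" and r: "0 < r" "r < R"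
    and M: "\<And>w. norm w \<le> r \<Longrightarrow> norm (V w) \<le> M"
    and s0: "s0 > 0" and B: "\<And>w. w \<noteq> 0 \<Longrightarrow> norm w < s0 \<Longrightarrow> norm (poly p w - V w) \<le> B * norm w ^ Suc d"
    and deg: "degree p \<le> d" and w: "norm w * (M + 2) \<le> r"
  shows "poly p w \<noteq> 0"
proof -
  define x where "x = norm w / r"
  have "x * (M + 2) \<le> 1" using w r by (simp add: x_def field_simps)
  then have x: "0 \<le> x" "x * (M + 2) \<le> 1" using r by (simp_all add: x_def)
  have c: "norm (coeff p n) \<le> M / r ^ n" if "n \<le> d" for n
    by (rule coeff_bound_of_taylor_poly[OF V(1) r M s0 B that])
  \<comment> \<open>The estimate between p and V excludes w = 0, so the constant coefficient is
    found as a limit.\<close>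
  have p0: "coeff p 0 = 1"
  proof -
    have "isCont V 0"
      using holomorphic_on_imp_continuous_on[OF V(1)] r by (simp add: continuous_on_eq_continuous_at)
    then have "isCont (\<lambda>w. poly p w - V w) 0" by (intro continuous_intros)
    then have l1: "((\<lambda>w. poly p w - V w) \<longlongrightarrow> poly p 0 - V 0) (at 0)" by (simp add: isCont_def)
    have "((\<lambda>w::complex. B * norm w ^ Suc d) \<longlongrightarrow> B * norm (0::complex) ^ Suc d) (at 0)"
      by (intro tendsto_intros)
    then have l2: "((\<lambda>w::complex. B * norm w ^ Suc d) \<longlongrightarrow> 0) (at 0)" by simp
    have "((\<lambda>w. poly p w - V w) \<longlongrightarrow> 0) (at 0)"
      by (rule Lim_null_comparison[OF _ l2]) (use B s0 in \<open>auto simp: eventually_at\<close>)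
    with l1 have "poly p 0 - V 0 = 0" by (rule LIM_unique)
    then show ?thesis using V(2) by (simp add: poly_0_coeff_0)
  qed
  have expand: "poly p w = 1 + (\<Sum>i<d. coeff p (Suc i) * w ^ Suc i)"
    unfolding poly_sum_atMost[OF deg] sum.atMost_shift by (simp add: p0)
  have "norm (\<Sum>i<d. coeff p (Suc i) * w ^ Suc i) \<le> (\<Sum>i<d. M * x * x ^ i)"
  proof (rule sum_norm_le)
    fix i assume "i \<in> {..<d}"
    then have "norm (coeff p (Suc i)) * norm w ^ Suc i \<le> M / r ^ Suc i * norm w ^ Suc i"
      by (intro mult_right_mono c) auto
    also have "\<dots> = M * x ^ Suc i" by (simp only: x_def power_divide) simp
    finally show "norm (coeff p (Suc i) * w ^ Suc i) \<le> M * x * x ^ i"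
      by (simp add: norm_mult norm_power algebra_simps)
  qed
  also have "(\<Sum>i<d. M * x * x ^ i) = M * x * (\<Sum>i<d. x ^ i)" by (simp only: sum_distrib_left)
  also have "\<dots> < 1"
  proof -
    have "(1 - x) * (\<Sum>i<d. x ^ i) = 1 - x ^ d" by (simp only: one_diff_power_eq)
    also have "\<dots> \<le> 1" using x(1) by simp
    finally have g: "(1 - x) * (\<Sum>i<d. x ^ i) \<le> 1" .
    have "M * x \<le> 1 - 2 * x" using x(2) by (simp add: algebra_simps)
    show ?thesis
    proof (cases "x = 0")
      case False
      then have xp: "x > 0" using x(1) by simp
      have S: "(\<Sum>i<d. x ^ i) \<ge> 0" by (intro sum_nonneg) (use x(1) in auto)
      show ?thesis
      proof (cases "(\<Sum>i<d. x ^ i) = 0")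
        case False
        then have "(\<Sum>i<d. x ^ i) > 0" using S by linarith
        then have "M * x * (\<Sum>i<d. x ^ i) < (1 - x) * (\<Sum>i<d. x ^ i)"
          using \<open>M * x \<le> 1 - 2 * x\<close> xp by (intro mult_strict_right_mono) auto
        then show ?thesis using g by linarith
      qed simp
    qed simp
  qed
  finally have less: "norm (\<Sum>i<d. coeff p (Suc i) * w ^ Suc i) < 1" .
  have "norm (\<Sum>i<d. coeff p (Suc i) * w ^ Suc i) = 1" if "1 + (\<Sum>i<d. coeff p (Suc i) * w ^ Suc i) = 0"
  proof -
    have "(\<Sum>i<d. coeff p (Suc i) * w ^ Suc i) = - 1" using that by (simp only: add_eq_0_iff)
    then show ?thesis by simp
  qed
  then show ?thesis using expand less by (metis less_irrefl)
qed

section \<open>Linear bounds and local inversion at the origin\<close>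

lemma holomorphic_lipschitz_at_0:
  assumes "f holomorphic_on ball 0 R" "R > 0"
  obtains K where "K > 0" "\<And>q. norm q \<le> R / 2 \<Longrightarrow> norm (f q - f 0) \<le> K * norm q"
proof -
  have "(\<lambda>q. f q - f 0) holomorphic_on ball 0 R" using assms by (intro holomorphic_intros)
  then obtain h where h: "h holomorphic_on ball 0 R" "\<And>q. norm q < R \<Longrightarrow> f q - f 0 = q * h q"
    "deriv (\<lambda>q. f q - f 0) 0 = h 0"
    by (rule Schwarz3, simp) (rule that)
  have "continuous_on (cball 0 (R / 2)) h"
    by (intro holomorphic_on_imp_continuous_on holomorphic_on_subset[OF h(1)])
      (use assms(2) in \<open>simp add: cball_subset_ball_iff\<close>)
  then have "bounded (h ` cball 0 (R / 2))"
    by (intro compact_imp_bounded compact_continuous_image) auto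
  then obtain K where K: "\<And>q. q \<in> cball 0 (R / 2) \<Longrightarrow> norm (h q) \<le> K"
    unfolding bounded_iff by blast
  show ?thesis
  proof (rule that)
    show "\<bar>K\<bar> + 1 > 0" by simp
    fix q :: complex assume q: "norm q \<le> R / 2"
    then have "norm (f q - f 0) = norm q * norm (h q)"
      using assms(2) by (subst h(2)) (auto simp: norm_mult)
    also have "\<dots> \<le> norm q * (\<bar>K\<bar> + 1)"
      using K[of q] q by (intro mult_left_mono) auto
    finally show "norm (f q - f 0) \<le> (\<bar>K\<bar> + 1) * norm q" by (simp add: mult.commute)
  qed
qed

text \<open>A nonzero derivative gives injectivity near 0. The inverse is kept inside the disc of
  radius R so that functions defined there can be composed with it.\<close>

lemma local_inverse_at_0:
  assumes f: "f holomorphic_on ball 0 R" "R > 0" "f 0 = 0" "deriv f 0 \<noteq> 0"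
  obtains \<delta> \<kappa> where "\<delta> > 0" "\<kappa> holomorphic_on ball 0 \<delta>" "\<kappa> 0 = 0"
    "\<And>w. norm w < \<delta> \<Longrightarrow> norm (\<kappa> w) < R \<and> f (\<kappa> w) = w"
proof -
  have "(0::complex) \<in> ball 0 R" using f(2) by simp
  then obtain r where r: "r > 0" "ball (0::complex) r \<subseteq> ball 0 R" "open (f ` ball 0 r)" "inj_on f (ball 0 r)"
    by (rule has_complex_derivative_locally_invertible[OF f(1) _ open_ball f(4)]) (rule that, assumption+)
  have fr: "f holomorphic_on ball 0 r" by (rule holomorphic_on_subset[OF f(1) r(2)])
  obtain g where g: "g holomorphic_on f ` ball 0 r"
    "\<And>z. z \<in> ball 0 r \<Longrightarrow> deriv f z * deriv g (f z) = 1" "\<And>z. z \<in> ball 0 r \<Longrightarrow> g (f z) = z"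
    by (rule holomorphic_has_inverse[OF fr open_ball r(4)]) (rule that)
  have "f 0 \<in> f ` ball 0 r" by (rule imageI) (use r(1) in simp)
  then obtain \<delta> where \<delta>: "\<delta> > 0" "ball 0 \<delta> \<subseteq> f ` ball 0 r"
    using r(3) f(3) unfolding open_contains_ball by auto
  show ?thesis
  proof (rule that[OF \<delta>(1) holomorphic_on_subset[OF g(1) \<delta>(2)]])
    have "g (f 0) = 0" by (rule g(3)) (use r(1) in simp)
    then show "g 0 = 0" by (simp only: f(3))
    fix w :: complex assume "norm w < \<delta>"
    then have "w \<in> f ` ball 0 r" using \<delta>(2) by auto
    then obtain z where z: "z \<in> ball 0 r" "w = f z" by blast
    have "g w = z" unfolding z(2) by (rule g(3)[OF z(1)])
    moreover have "norm z < R" using z(1) r(2) by auto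
    ultimately show "norm (g w) < R \<and> f (g w) = w" using z(2) by simp
  qed
qed

section \<open>Factorization of Miller forms\<close>

text \<open>For k mod 12 = 0, 2, 4, 6, 8, 10 the pair (a, b) is (0,0), (1,1), (2,0), (0,1), (1,0),
  (2,1). Each Eisenstein series that occurs raises the exponent of Delta by one above
  \<open>miller_ell k\<close>; a forced linear factor in j absorbs each surplus.\<close>

lemma weight_complement:
  fixes k :: nat
  assumes "even k" "k \<ge> 4"
  obtains a b where "a < 3" "b < 2"
    "k + 4 * a + 6 * b = 12 * (miller_ell k + (if a = 0 then 0 else 1) + (if b = 0 then 0 else 1))"
proof -
  define t where "t = k div 12"
  define r where "r = k mod 12"
  have k: "k = 12 * t + r" "r < 12" by (simp_all add: t_def r_def)
  have "even r" using assms(1) k(1) by simp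
  then have "r = 0 \<or> r = 2 \<or> r = 4 \<or> r = 6 \<or> r = 8 \<or> r = 10" using k(2) by presburger
  moreover have ml: "miller_ell k = (if r = 2 then t - 1 else t)"
    by (simp add: miller_ell_def r_def t_def)
  have t: "r = 2 \<Longrightarrow> t \<ge> 1" using assms(2) k by auto
  ultimately show ?thesis
  proof (elim disjE)
    assume "r = 0" then show ?thesis using that[of 0 0] ml k(1) by simp
  next
    assume "r = 2" then show ?thesis using that[of 1 1] ml k(1) t by simp
  next
    assume "r = 4" then show ?thesis using that[of 2 0] ml k(1) by simp
  next
    assume "r = 6" then show ?thesis using that[of 0 1] ml k(1) by simp
  next
    assume "r = 8" then show ?thesis using that[of 1 0] ml k(1) by simp
  next
    assume "r = 10" then show ?thesis using that[of 2 1] ml k(1) by simp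
  qed
qed

text \<open>There are at most two forced factors, so this keeps the exponents L and n of the
  explicit function at most k.\<close>

lemma miller_ell_bound: "k \<ge> 4 \<Longrightarrow> miller_ell k + 2 \<le> k"
  unfolding miller_ell_def by (auto split: if_splits)

lemma poly_factor_root:
  fixes P :: "complex poly"
  assumes "degree P \<le> Suc n" "poly P x = 0"
  obtains Q where "degree Q \<le> n" "P = [:- x, 1:] * Q"
proof -
  obtain Q where Q: "P = [:- x, 1:] * Q" using assms(2) by (metis dvdE poly_eq_0_iff_dvd)
  have "degree Q \<le> n"
  proof (cases "Q = 0")
    case False
    then have "degree P = Suc (degree Q)" unfolding Q by (subst degree_mult_eq) auto
    then show ?thesis using assms(1) by simp
  qed simp
  then show ?thesis using Q that by blast
qed

lemma poly_factor_two_roots: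
  fixes P :: "complex poly"
  assumes deg: "degree P \<le> n + (if A then 1 else 0) + (if B then 1 else 0)"
    and A: "A \<Longrightarrow> poly P x = 0" and B: "B \<Longrightarrow> poly P y = 0" and xy: "x \<noteq> y"
  obtains Q where "degree Q \<le> n"
    "P = [:- x, 1:] ^ (if A then 1 else 0) * [:- y, 1:] ^ (if B then 1 else 0) * Q"
proof -
  obtain P1 where P1: "degree P1 \<le> n + (if B then 1 else 0)" "P = [:- x, 1:] ^ (if A then 1 else 0) * P1"
  proof (cases A)
    case True
    then show ?thesis using poly_factor_root[OF _ A, of "n + (if B then 1 else 0)"] deg that by auto
  next
    case False
    then show ?thesis using that[of P] deg by simp
  qed
  have B1: "poly P1 y = 0" if B
    using B[OF that] xy unfolding P1(2) by (auto split: if_splits)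
  obtain Q where "degree Q \<le> n" "P1 = [:- y, 1:] ^ (if B then 1 else 0) * Q"
  proof (cases B)
    case True
    then show ?thesis using poly_factor_root[OF _ B1, of n] P1(1) that by auto
  next
    case False
    then show ?thesis using that[of P1] P1(1) by simp
  qed
  then show ?thesis using that P1(2) by (simp add: mult.assoc)
qed

text \<open>Division by q^m leaves the error exponent d + 1 for d = \<open>miller_ell k - m\<close>,
  one above the later degree bound; this is what makes a polynomial of degree d an exact Taylor
  polynomial.\<close>

lemma miller_form_ratio_bound:
  assumes g: "miller_form k m g" and m: "m \<le> miller_ell k"
  obtains B where "B \<ge> 0"
    "\<And>z. Im z \<ge> 1 \<Longrightarrow> norm (g z / qvar z ^ m - 1) \<le> B * norm (qvar z) ^ Suc (miller_ell k - m)"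
proof -
  obtain B where B: "\<And>z. Im z \<ge> 1 \<Longrightarrow> norm (g z - qvar z ^ m) \<le> B * norm (qvar z) ^ (miller_ell k + 1)"
    using g unfolding miller_form_def qexp_leading_def by blast
  show ?thesis
  proof (rule that[of "\<bar>B\<bar>"])
    fix z assume z: "Im z \<ge> 1"
    have "g z / qvar z ^ m - 1 = (g z - qvar z ^ m) / qvar z ^ m" by (simp add: diff_divide_distrib)
    then have "norm (g z / qvar z ^ m - 1) = norm (g z - qvar z ^ m) / norm (qvar z) ^ m"
      by (simp only: norm_divide norm_power)
    also have "\<dots> \<le> \<bar>B\<bar> * norm (qvar z) ^ (miller_ell k + 1) / norm (qvar z) ^ m"
      by (intro divide_right_mono order_trans[OF B[OF z]] mult_right_mono) auto
    also have "miller_ell k + 1 = Suc (miller_ell k - m) + m" using m by simp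
    also have "\<bar>B\<bar> * norm (qvar z) ^ (Suc (miller_ell k - m) + m) / norm (qvar z) ^ m =
        \<bar>B\<bar> * norm (qvar z) ^ Suc (miller_ell k - m)"
      by (simp only: power_add) simp
    finally show "norm (g z / qvar z ^ m - 1) \<le> \<bar>B\<bar> * norm (qvar z) ^ Suc (miller_ell k - m)" .
  qed simp
qed

text \<open>Multiplying by \<open>E\<^sub>4\<^sup>a E\<^sub>6\<^sup>b\<close> brings \<open>g\<close> to a weight divisible by 12. The zeros of \<open>E\<^sub>4\<close> at
  \<open>\<rho>\<close> and of \<open>E\<^sub>6\<close> at \<open>\<i>\<close> account for the linear factors.\<close>

lemma miller_form_factorization:
  assumes g: "miller_form k m g" and m: "m \<le> miller_ell k"
    and L: "L = miller_ell k + (if a = 0 then 0 else 1) + (if b = 0 then 0 else 1)"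
    and kL: "k + 4 * a + 6 * b = 12 * L"
  obtains F where "degree F \<le> miller_ell k - m"
    "\<And>z. Im z > 0 \<Longrightarrow> g z * eisenstein4 (qvar z) ^ a * eisenstein6 (qvar z) ^ b =
       delta (qvar z) ^ L * (klein_j z ^ (if a = 0 then 0 else 1) * (klein_j z - 1728) ^ (if b = 0 then 0 else 1)
         * poly F (klein_j z))"
proof -
  from g have hol: "g holomorphic_on upper_half_plane" and T: "\<And>z. Im z > 0 \<Longrightarrow> g (z + 1) = g z"
    and S: "\<And>z. Im z > 0 \<Longrightarrow> g (- 1 / z) = z ^ k * g z"
    by (auto simp: miller_form_def modular_form_def upper_half_plane_def)
  define G where "G = (\<lambda>z. g z * (eisenstein4 (qvar z) ^ a * eisenstein6 (qvar z) ^ b) / delta (qvar z) ^ L)"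
  have "modular_function G"
    unfolding modular_function_def
  proof (intro conjI allI impI)
    show "G holomorphic_on upper_half_plane"
      unfolding G_def
      by (intro holomorphic_on_divide holomorphic_on_mult holomorphic_on_power compose_qvar_holomorphic hol
          eisenstein4_holomorphic eisenstein6_holomorphic delta_holomorphic) simp
    fix z :: complex assume z: "Im z > 0"
    show "G (z + 1) = G z" by (simp add: G_def qvar_add_1 T[OF z])
    define X where "X = eisenstein4 (qvar z)"
    define Y where "Y = eisenstein6 (qvar z)"
    define D where "D = delta (qvar z)"
    have z0: "z \<noteq> 0" using z by auto
    have "z ^ k * g z * ((z ^ 4 * X) ^ a * (z ^ 6 * Y) ^ b) = z ^ (k + 4 * a + 6 * b) * (g z * (X ^ a * Y ^ b))"
      by (simp only: power_add power_mult power_mult_distrib) (simp only: mult_ac)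
    also have "\<dots> = (z ^ 12) ^ L * (g z * (X ^ a * Y ^ b))" by (simp only: kL power_mult)
    finally show "G (- 1 / z) = G z"
      unfolding G_def S[OF z] eisenstein4_inversion[OF z] eisenstein6_inversion[OF z] delta_inversion[OF z]
        X_def [symmetric] Y_def [symmetric] D_def [symmetric]
      using z0 by (simp only: power_mult_distrib[of "z ^ 12"]) simp
  qed
  \<comment> \<open>The product q^(L-m) G is g/q^m times a function regular at q = 0, so G has a
    pole of order at most L - m at the cusp.\<close>
  moreover have "\<exists>B. \<forall>z. Im z \<ge> 1 \<longrightarrow> norm (qvar z ^ (L - m) * G z) \<le> B"
  proof -
    obtain B where B: "B \<ge> 0"
      "\<And>z. Im z \<ge> 1 \<Longrightarrow> norm (g z / qvar z ^ m - 1) \<le> B * norm (qvar z) ^ Suc (miller_ell k - m)"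
      using miller_form_ratio_bound[OF g m] by blast
    define h where "h = (\<lambda>q. eisenstein4 q ^ a * eisenstein6 q ^ b / exp (delta_log q) ^ L)"
    have "h holomorphic_on ball 0 1" unfolding h_def by (intro holomorphic_intros) auto
    then obtain B' where B': "\<And>q. norm q \<le> exp (- 2 * pi) \<Longrightarrow> norm (h q) \<le> B'"
      using bounded_on_compact_disc by blast
    have "norm (qvar z ^ (L - m) * G z) \<le> (1 + B) * B'" if z: "Im z \<ge> 1" for z
    proof -
      have "delta (qvar z) ^ L = qvar z ^ (L - m) * qvar z ^ m * exp (delta_log (qvar z)) ^ L"
      proof -
        have "L - m + m = L" using m L by simp
        then show ?thesis by (simp only: delta_def power_mult_distrib power_add [symmetric])
      qed
      then have "qvar z ^ (L - m) * G z = (g z / qvar z ^ m) * h (qvar z)"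
        by (simp add: G_def h_def)
      then have "norm (qvar z ^ (L - m) * G z) = norm (g z / qvar z ^ m) * norm (h (qvar z))"
        by (simp only: norm_mult)
      also have "\<dots> \<le> (1 + B) * B'"
      proof (rule mult_mono)
        have "norm (g z / qvar z ^ m) \<le> norm (g z / qvar z ^ m - 1) + norm (1::complex)"
          using norm_triangle_ineq[of "g z / qvar z ^ m - 1" 1] by simp
        also have "norm (g z / qvar z ^ m - 1) \<le> B * 1"
        proof (rule order_trans[OF B(2)[OF z]], rule mult_left_mono)
          show "norm (qvar z) ^ Suc (miller_ell k - m) \<le> 1"
            using norm_qvar_less_1[of z] z by (intro power_le_one) auto
        qed (rule B(1))
        finally show "norm (g z / qvar z ^ m) \<le> 1 + B" by simp
        show "norm (h (qvar z)) \<le> B'"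
          by (rule B') (use z in \<open>simp add: norm_qvar\<close>)
      qed (use B(1) in auto)
      finally show ?thesis .
    qed
    then show ?thesis by blast
  qed
  ultimately obtain P where P: "degree P \<le> L - m" "\<And>z. Im z > 0 \<Longrightarrow> G z = poly P (klein_j z)"
    using modular_function_poly_klein_j by blast
  have P0: "poly P 0 = 0" if "a \<noteq> 0"
    using P(2)[OF rho_cube(3)] that by (simp add: G_def klein_j_rho eisenstein4_rho power_0_left)
  have P1728: "poly P 1728 = 0" if "b \<noteq> 0"
    using P(2)[of \<i>] that by (simp add: G_def klein_j_i eisenstein6_i power_0_left)
  \<comment> \<open>L - m exceeds \<open>miller_ell k - m\<close> by exactly the number of forced
    roots, so splitting them off leaves the required degree.\<close>
  have "degree P \<le> (miller_ell k - m) + (if a \<noteq> 0 then 1 else 0) + (if b \<noteq> 0 then 1 else 0)"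
    using P(1) m L by (auto split: if_splits)
  then obtain F where F: "degree F \<le> miller_ell k - m"
    "P = [:- 0, 1:] ^ (if a \<noteq> 0 then 1 else 0) * [:- 1728, 1:] ^ (if b \<noteq> 0 then 1 else 0) * F"
    by (rule poly_factor_two_roots[OF _ P0 P1728]) (assumption, assumption, simp, rule that)
  show ?thesis
  proof (rule that[OF F(1)])
    fix z :: complex assume z: "Im z > 0"
    have "g z * eisenstein4 (qvar z) ^ a * eisenstein6 (qvar z) ^ b = delta (qvar z) ^ L * G z"
      by (simp add: G_def)
    also have "G z = klein_j z ^ (if a = 0 then 0 else 1) * (klein_j z - 1728) ^ (if b = 0 then 0 else 1)
         * poly F (klein_j z)"
      unfolding P(2)[OF z] F(2) by (simp add: poly_power)
    finally show "g z * eisenstein4 (qvar z) ^ a * eisenstein6 (qvar z) ^ b =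
       delta (qvar z) ^ L * (klein_j z ^ (if a = 0 then 0 else 1) * (klein_j z - 1728) ^ (if b = 0 then 0 else 1)
         * poly F (klein_j z))" .
  qed
qed

section \<open>Zeros of Miller forms\<close>

definition inverse_j :: "complex \<Rightarrow> complex" where
  "inverse_j q = delta q / eisenstein4 q ^ 3"

text \<open>The quotient of 1/j by q in a form that makes sense at q = 0, where it equals 1.\<close>

definition inverse_j_unit :: "complex \<Rightarrow> complex" where
  "inverse_j_unit q = exp (delta_log q) / eisenstein4 q ^ 3"

lemma inverse_j_eq: "inverse_j q = q * inverse_j_unit q"
  by (simp add: inverse_j_def inverse_j_unit_def delta_def)

lemma klein_j_eq_inverse: "klein_j z = 1 / inverse_j (qvar z)"
  by (simp add: klein_j_def inverse_j_def)

text \<open>R < exp(-2 pi) places the nomes with |q| < R in the region Im z > 1, where the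
  q-expansion bound of a Miller form is available.\<close>

lemma inverse_j_local:
  obtains R where "0 < R" "R < exp (- 2 * pi)"
    "\<And>q. norm q < R \<Longrightarrow> eisenstein4 q \<noteq> 0 \<and> 1 - 1728 * inverse_j q \<noteq> 0"
    "inverse_j_unit holomorphic_on ball 0 R" "inverse_j holomorphic_on ball 0 R"
    "inverse_j_unit 0 = 1" "deriv inverse_j 0 = 1"
proof -
  have c4: "isCont eisenstein4 0"
    using holomorphic_on_imp_continuous_on[OF eisenstein4_holomorphic] by (simp add: continuous_on_eq_continuous_at)
  have cd: "isCont delta 0"
    using holomorphic_on_imp_continuous_on[OF delta_holomorphic] by (simp add: continuous_on_eq_continuous_at)
  have "isCont inverse_j 0"
    unfolding inverse_j_def [abs_def] using c4 cd by (intro continuous_intros) (auto simp: eisenstein_at_0)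
  then have "isCont (\<lambda>q. eisenstein4 q * (1 - 1728 * inverse_j q)) 0"
    using c4 by (intro continuous_intros)
  then have "((\<lambda>q. eisenstein4 q * (1 - 1728 * inverse_j q)) \<longlongrightarrow> eisenstein4 0 * (1 - 1728 * inverse_j 0)) (at 0)"
    unfolding isCont_def .
  moreover have "eisenstein4 0 * (1 - 1728 * inverse_j 0) = 1"
    by (simp add: eisenstein_at_0 inverse_j_eq)
  ultimately have "eventually (\<lambda>q. eisenstein4 q * (1 - 1728 * inverse_j q) \<noteq> 0) (at 0)"
    by (metis tendsto_imp_eventually_ne zero_neq_one)
  then obtain s where s: "s > 0" "\<And>q. q \<noteq> 0 \<Longrightarrow> norm q < s \<Longrightarrow> eisenstein4 q * (1 - 1728 * inverse_j q) \<noteq> 0"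
    unfolding eventually_at by (auto simp: dist_norm)
  define R where "R = min s (exp (- 2 * pi) / 2)"
  have "0 < R" using s(1) by (simp add: R_def)
  moreover have "R \<le> s" "R \<le> exp (- 2 * pi) / 2"
    unfolding R_def by (rule min.cobounded1, rule min.cobounded2)
  ultimately have R: "0 < R" "R \<le> s" "R \<le> exp (- 2 * pi) / 2" by blast+
  have R2: "R < exp (- 2 * pi)" by (rule le_less_trans[OF R(3)]) simp
  have R1: "R < 1" by (rule less_trans[OF R2]) simp
  have nz: "eisenstein4 q \<noteq> 0 \<and> 1 - 1728 * inverse_j q \<noteq> 0" if "norm q < R" for q
  proof (cases "q = 0")
    case True
    then show ?thesis by (simp add: eisenstein_at_0 inverse_j_eq)
  next
    case False
    with s(2)[of q] that R(2) show ?thesis by auto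
  qed
  have sub: "ball (0::complex) R \<subseteq> ball 0 1" using R1 by auto
  have u: "inverse_j_unit holomorphic_on ball 0 R"
    unfolding inverse_j_unit_def [abs_def]
    by (intro holomorphic_intros holomorphic_on_subset[OF eisenstein4_holomorphic sub]
        holomorphic_on_subset[OF delta_log_holomorphic sub]) (use nz in auto)
  have j: "inverse_j holomorphic_on ball 0 R"
    unfolding inverse_j_eq [abs_def] using u by (intro holomorphic_intros)
  have u0: "inverse_j_unit 0 = 1" by (simp add: inverse_j_unit_def delta_log eisenstein_at_0)
  have "(inverse_j_unit has_field_derivative deriv inverse_j_unit 0) (at 0)"
    by (rule holomorphic_derivI[OF u open_ball]) (use R in simp)
  then have "((\<lambda>q. q * inverse_j_unit q) has_field_derivative 1) (at 0)"
    using u0 by (auto intro!: derivative_eq_intros)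
  then have "deriv inverse_j 0 = 1"
    unfolding inverse_j_eq [abs_def] by (rule DERIV_imp_deriv)
  then show ?thesis using that[OF R(1) R2 nz u j u0] by blast
qed

text \<open>The exponent d is prescribed instead of being read off F, because F may have smaller
  degree while the factor w^d stays the same.\<close>

definition reversed_poly :: "nat \<Rightarrow> complex poly \<Rightarrow> complex poly" where
  "reversed_poly d F = (\<Sum>i\<le>d. monom (coeff F i) (d - i))"

lemma degree_reversed_poly: "degree (reversed_poly d F) \<le> d"
  unfolding reversed_poly_def by (intro degree_sum_le) (auto intro: order_trans[OF degree_monom_le])

lemma poly_reversed_poly:
  assumes "degree F \<le> d" "w \<noteq> 0"
  shows "poly (reversed_poly d F) w = w ^ d * poly F (1 / w)"
proof -
  have *: "w ^ d * (coeff F i * (1 / w) ^ i) = coeff F i * w ^ (d - i)" if "i \<le> d" for i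
    using that assms(2) by (simp add: power_diff power_divide field_simps)
  show ?thesis
    unfolding poly_sum_atMost[OF assms(1)] reversed_poly_def poly_sum poly_monom sum_distrib_left
    by (rule sum.cong[OF refl], rule *[symmetric]) simp
qed

text \<open>The source of uniformity in the weight: N factors of size 1 + K/N have product at most
  exp K.\<close>

lemma one_plus_power_le:
  assumes "0 \<le> K" "n \<le> N" "0 \<le> x" "real N * x \<le> 1"
  shows "(1 + K * x) ^ n \<le> exp K"
proof -
  have "(1 + K * x) ^ n \<le> (1 + K * x) ^ N" using assms by (intro power_increasing) auto
  also have "\<dots> \<le> exp (K * x) ^ N" using assms exp_ge_add_one_self[of "K * x"] by (intro power_mono) auto
  also have "\<dots> = exp (K * (real N * x))" by (simp add: exp_of_nat_mult [symmetric] mult_ac)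
  also have "\<dots> \<le> exp (K * 1)" unfolding exp_le_cancel_iff using assms by (intro mult_left_mono) auto
  finally show ?thesis by simp
qed

text \<open>For fixed (a, b) the same few functions of q serve all weights; k and m enter only
  through exponents of size at most k. So C can be chosen before k, m and g.\<close>

lemma miller_form_zero_bound_fixed_weight_class:
  fixes a b :: nat
  obtains C where "C > 0"
    "\<And>k m g z. k \<ge> 4 \<Longrightarrow> m \<le> miller_ell k \<Longrightarrow> miller_form k m g \<Longrightarrow>
       k + 4 * a + 6 * b = 12 * (miller_ell k + (if a = 0 then 0 else 1) + (if b = 0 then 0 else 1)) \<Longrightarrow>
       norm (qvar z) * real k \<le> C \<Longrightarrow> g z \<noteq> 0"
proof -
  define \<alpha> where "\<alpha> = (if a = 0 then 0 else 1 :: nat)"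
  define \<beta> where "\<beta> = (if b = 0 then 0 else 1 :: nat)"
  obtain R where R: "0 < R" "R < exp (- 2 * pi)"
    and nz: "\<And>q. norm q < R \<Longrightarrow> eisenstein4 q \<noteq> 0 \<and> 1 - 1728 * inverse_j q \<noteq> 0"
    and u: "inverse_j_unit holomorphic_on ball 0 R" and j: "inverse_j holomorphic_on ball 0 R"
    and u0: "inverse_j_unit 0 = 1" and dj: "deriv inverse_j 0 = 1"
    by (rule inverse_j_local) (rule that)
  have R1: "R < 1" by (rule less_trans[OF R(2)]) simp
  have sub: "ball (0::complex) R \<subseteq> ball 0 1" using R1 by auto
  note hol4 = holomorphic_on_subset[OF eisenstein4_holomorphic sub]
  note hol6 = holomorphic_on_subset[OF eisenstein6_holomorphic sub]
  define v where "v = (\<lambda>q. exp (- delta_log q))"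
  have v: "v holomorphic_on ball 0 R"
    unfolding v_def by (intro holomorphic_intros holomorphic_on_subset[OF delta_log_holomorphic sub])
  have v0: "v 0 = 1" by (simp add: v_def delta_log)
  \<comment> \<open>The single bounded factor of V: its exponents are fixed by (a, b), while the
    factors with growing exponents are kept apart in W.\<close>
  define Y where "Y = (\<lambda>q. eisenstein4 q ^ a * eisenstein6 q ^ b / (1 - 1728 * inverse_j q) ^ \<beta>)"
  have Y: "Y holomorphic_on ball 0 R"
    unfolding Y_def by (intro holomorphic_intros hol4 hol6 j) (use nz in auto)
  have j0: "inverse_j 0 = 0" by (simp add: inverse_j_eq)
  have Y0: "Y 0 = 1" by (simp add: Y_def eisenstein_at_0 j0)
  obtain \<delta> \<kappa> where \<delta>: "\<delta> > 0" and \<kappa>: "\<kappa> holomorphic_on ball 0 \<delta>" "\<kappa> 0 = 0"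
    and \<kappa>_inv: "\<And>w. norm w < \<delta> \<Longrightarrow> norm (\<kappa> w) < R \<and> inverse_j (\<kappa> w) = w"
    by (rule local_inverse_at_0[OF j R(1) j0]) (use dj in simp, rule that)
  obtain K1 where K1: "K1 > 0" "\<And>q. norm q \<le> R / 2 \<Longrightarrow> norm (inverse_j_unit q - inverse_j_unit 0) \<le> K1 * norm q"
    using holomorphic_lipschitz_at_0[OF u R(1)] by blast
  obtain K2 where K2: "K2 > 0" "\<And>q. norm q \<le> R / 2 \<Longrightarrow> norm (v q - v 0) \<le> K2 * norm q"
    using holomorphic_lipschitz_at_0[OF v R(1)] by blast
  obtain K3 where K3: "K3 > 0" "\<And>q. norm q \<le> R / 2 \<Longrightarrow> norm (Y q - Y 0) \<le> K3 * norm q"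
    using holomorphic_lipschitz_at_0[OF Y R(1)] by blast
  obtain K4 where K4: "K4 > 0" "\<And>w. norm w \<le> \<delta> / 2 \<Longrightarrow> norm (\<kappa> w - \<kappa> 0) \<le> K4 * norm w"
    using holomorphic_lipschitz_at_0[OF \<kappa>(1) \<delta>] by blast
  have near_1: "norm x \<le> 1 + y" if "norm (x - 1) \<le> y" for x :: complex and y
    using that norm_triangle_ineq[of "x - 1" 1] by simp
  have bu: "norm (inverse_j_unit q) \<le> 1 + K1 * norm q" if "norm q \<le> R / 2" for q
    using K1(2)[OF that] unfolding u0 by (rule near_1)
  have bv: "norm (v q) \<le> 1 + K2 * norm q" if "norm q \<le> R / 2" for q
    using K2(2)[OF that] unfolding v0 by (rule near_1)
  have bY: "norm (Y q) \<le> 1 + K3 * norm q" if "norm q \<le> R / 2" for q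
    using K3(2)[OF that] unfolding Y0 by (rule near_1)
  have b\<kappa>: "norm (\<kappa> w) \<le> K4 * norm w" if "norm w \<le> \<delta> / 2" for w
    using K4(2)[OF that] unfolding \<kappa>(2) by simp
  define M where "M = (1 + K3) * (exp K1 * exp K2)"
  have M: "M > 0" using K3(1) by (simp add: M_def add_pos_pos)
  \<comment> \<open>Chosen so that |w| <= c/k implies |q| <= R/2 and k |q| <= 1 for q =
    \<open>\<kappa> w\<close>.\<close>
  define c where "c = min (\<delta> / 2) (min (R / 2) 1 / K4)"
  have c: "c > 0" "c \<le> \<delta> / 2" "K4 * c \<le> R / 2" "K4 * c \<le> 1"
  proof -
    show "c > 0" using \<delta> R(1) K4(1) by (simp add: c_def)
    show "c \<le> \<delta> / 2" unfolding c_def by (rule min.cobounded1)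
    have "c \<le> min (R / 2) 1 / K4" unfolding c_def by (rule min.cobounded2)
    then have "K4 * c \<le> min (R / 2) 1" using K4(1) by (simp add: pos_le_divide_eq mult.commute)
    then show "K4 * c \<le> R / 2" "K4 * c \<le> 1" by simp_all
  qed
  \<comment> \<open>Here |1/j| <= (1 + K1)|q|, so k |q| <= C yields |1/j| (M + 2) <= c/k, the
    hypothesis of the zero-free criterion.\<close>
  define C where "C = min (c / ((1 + K1) * (M + 2))) (R / 2)"
  have C: "C > 0" "C * ((1 + K1) * (M + 2)) \<le> c" "C \<le> R / 2"
  proof -
    have p: "(1 + K1) * (M + 2) > 0" using K1(1) M by simp
    show "C > 0" using p c(1) R(1) by (simp add: C_def)
    have "C \<le> c / ((1 + K1) * (M + 2))" unfolding C_def by (rule min.cobounded1)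
    then show "C * ((1 + K1) * (M + 2)) \<le> c" using p by (simp add: pos_le_divide_eq)
    show "C \<le> R / 2" unfolding C_def by (rule min.cobounded2)
  qed
  show ?thesis
  proof (rule that[OF C(1)])
    fix k m :: nat and g :: "complex \<Rightarrow> complex" and z :: complex
    assume k: "k \<ge> 4" and m: "m \<le> miller_ell k" and g: "miller_form k m g"
      and kL: "k + 4 * a + 6 * b = 12 * (miller_ell k + (if a = 0 then 0 else 1) + (if b = 0 then 0 else 1))"
      and zC: "norm (qvar z) * real k \<le> C"
    define d where "d = miller_ell k - m"
    define L where "L = miller_ell k + \<alpha> + \<beta>"
    define n where "n = d + \<alpha> + \<beta>"
    have Ln: "L = n + m" using m by (simp add: L_def n_def d_def)
    have "\<alpha> + \<beta> \<le> 2" by (simp add: \<alpha>_def \<beta>_def)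
    then have Lk: "L \<le> k" "n \<le> k" using miller_ell_bound[OF k] Ln by (simp_all add: L_def)
    obtain F where F: "degree F \<le> d"
      "\<And>z. Im z > 0 \<Longrightarrow> g z * eisenstein4 (qvar z) ^ a * eisenstein6 (qvar z) ^ b =
         delta (qvar z) ^ L * (klein_j z ^ \<alpha> * (klein_j z - 1728) ^ \<beta> * poly F (klein_j z))"
      using miller_form_factorization[OF g m _ kL] unfolding L_def \<alpha>_def \<beta>_def d_def by blast
    obtain B where B: "B \<ge> 0"
      "\<And>z. Im z \<ge> 1 \<Longrightarrow> norm (g z / qvar z ^ m - 1) \<le> B * norm (qvar z) ^ Suc d"
      using miller_form_ratio_bound[OF g m] unfolding d_def by blast
    define p where "p = reversed_poly d F"
    define W where "W = (\<lambda>q. Y q * inverse_j_unit q ^ n * v q ^ L)"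
    \<comment> \<open>With w = q U and Delta = q E the powers of q balance because L = n + m. What
      remains is g/q^m times the explicit W.\<close>
    have Wp: "poly p (inverse_j (qvar z)) = g z / qvar z ^ m * W (qvar z)" and Imz: "Im z > 1"
      if z: "norm (qvar z) < R" for z
    proof -
      have "norm (qvar z) < exp (- 2 * pi)" using z R(2) by linarith
      then have "- 2 * pi * Im z < - 2 * pi * 1" unfolding norm_qvar exp_less_cancel_iff by simp
      then show "Im z > 1" by simp
      define q where "q = qvar z"
      define \<omega> where "\<omega> = inverse_j q"
      define U where "U = inverse_j_unit q"
      define E where "E = exp (delta_log q)"
      define X where "X = eisenstein4 q ^ a * eisenstein6 q ^ b"
      have q0: "q \<noteq> 0" by (simp add: q_def)
      have E0: "E \<noteq> 0" by (simp add: E_def)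
      have e4: "eisenstein4 q \<noteq> 0" and w1: "1 - 1728 * \<omega> \<noteq> 0" using nz z by (auto simp: q_def \<omega>_def)
      have U0: "U \<noteq> 0" using e4 by (simp add: U_def inverse_j_unit_def)
      have \<omega>U: "\<omega> = q * U" by (simp add: \<omega>_def U_def inverse_j_eq)
      have \<omega>0: "\<omega> \<noteq> 0" using q0 U0 by (simp add: \<omega>U)
      have "1 / \<omega> - 1728 = (1 - 1728 * \<omega>) / \<omega>" using \<omega>0 by (simp add: field_simps)
      then have "g z * X = (q * E) ^ L * ((1 / \<omega>) ^ \<alpha> * ((1 - 1728 * \<omega>) / \<omega>) ^ \<beta> * poly F (1 / \<omega>))"
        using F(2)[of z] \<open>Im z > 1\<close>
        unfolding X_def q_def [symmetric] klein_j_eq_inverse \<omega>_def [symmetric] E_def delta_def by (simp add: mult.assoc)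
      then have gX: "g z * X * (\<omega> ^ \<alpha> * \<omega> ^ \<beta> * \<omega> ^ d) =
          (q * E) ^ L * (1 - 1728 * \<omega>) ^ \<beta> * (\<omega> ^ d * poly F (1 / \<omega>))"
        using \<omega>0 by (simp add: power_divide)
      have "poly p \<omega> = \<omega> ^ d * poly F (1 / \<omega>)"
        unfolding p_def by (rule poly_reversed_poly[OF F(1) \<omega>0])
      then have gX': "g z * X * \<omega> ^ n = (q * E) ^ L * (1 - 1728 * \<omega>) ^ \<beta> * poly p \<omega>"
        using gX by (simp add: n_def power_add mult_ac)
      have vE: "v q = 1 / E" by (simp add: v_def E_def exp_minus inverse_eq_divide)
      have "W q = X / (1 - 1728 * \<omega>) ^ \<beta> * U ^ n * (1 / E) ^ L"
        by (simp add: W_def Y_def X_def U_def vE \<omega>_def)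
      then have "g z / q ^ m * W q = g z * X * \<omega> ^ n / ((q * E) ^ L * (1 - 1728 * \<omega>) ^ \<beta>)"
        using q0 E0 w1 by (simp add: \<omega>U Ln power_add power_mult_distrib power_divide field_simps)
      also have "\<dots> = poly p \<omega>" unfolding gX' using q0 E0 w1 by simp
      finally show "poly p (inverse_j (qvar z)) = g z / qvar z ^ m * W (qvar z)"
        by (simp only: q_def \<omega>_def)
    qed
    define r where "r = c / real k"
    have kp: "real k \<ge> 1" using k by simp
    have r: "0 < r" "r \<le> c" "r * real k = c"
      using c(1) kp by (simp_all add: r_def divide_le_eq mult_left_mono)
    have W: "W holomorphic_on ball 0 R" unfolding W_def using Y u v by (intro holomorphic_intros)
    define V where "V = (\<lambda>w. W (\<kappa> w))"
    have V: "V holomorphic_on ball 0 \<delta>"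
    proof -
      have "\<kappa> ` ball 0 \<delta> \<subseteq> ball 0 R" by (rule image_subsetI) (use \<kappa>_inv in simp)
      from holomorphic_on_compose_gen[OF \<kappa>(1) W this] show ?thesis unfolding V_def o_def .
    qed
    have V0: "V 0 = 1" by (simp add: V_def W_def \<kappa>(2) Y0 u0 v0)
    have \<kappa>r: "norm (\<kappa> w) \<le> R / 2 \<and> real k * norm (\<kappa> w) \<le> 1 \<and> norm (\<kappa> w) \<le> 1" if w: "norm w \<le> r" for w
    proof -
      have "norm (\<kappa> w) \<le> K4 * norm w" using w r(2) c(2) by (intro b\<kappa>) simp
      also have "\<dots> \<le> K4 * r" using w K4(1) by (intro mult_left_mono) auto
      finally have *: "norm (\<kappa> w) \<le> K4 * r" .
      have **: "K4 * r \<le> K4 * c" using r(2) K4(1) by (intro mult_left_mono) auto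
      have "real k * norm (\<kappa> w) \<le> real k * (K4 * r)" using * by (intro mult_left_mono) auto
      also have "\<dots> = K4 * c" using r(3) by (simp add: mult_ac flip: r(3))
      finally show ?thesis using * ** c(3,4) by linarith
    qed
    \<comment> \<open>There are at most k factors 1 + K1 |q| and at most k factors 1 + K2 |q|, with
      k |q| <= 1, besides the bounded factor Y.\<close>
    have VM: "norm (V w) \<le> M" if w: "norm w \<le> r" for w
    proof -
      define q where "q = \<kappa> w"
      have q: "norm q \<le> R / 2" "real k * norm q \<le> 1" "norm q \<le> 1" using \<kappa>r[OF w] by (simp_all add: q_def)
      have "norm (V w) = norm (Y q) * (norm (inverse_j_unit q) ^ n * norm (v q) ^ L)"
        by (simp add: V_def W_def q_def norm_mult norm_power)
      also have "\<dots> \<le> (1 + K3) * (exp K1 * exp K2)"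
      proof (intro mult_mono)
        have "K3 * norm q \<le> K3 * 1" using K3(1) q(3) by (intro mult_left_mono) auto
        then show "norm (Y q) \<le> 1 + K3" using bY[OF q(1)] by linarith
        show "norm (inverse_j_unit q) ^ n \<le> exp K1"
          using power_mono[OF bu[OF q(1)], of n] one_plus_power_le[of K1 n k "norm q"] K1(1) Lk q(2) by force
        show "norm (v q) ^ L \<le> exp K2"
          using power_mono[OF bv[OF q(1)], of L] one_plus_power_le[of K2 L k "norm q"] K2(1) Lk q(2) by force
      qed (use K3(1) in auto)
      finally show ?thesis by (simp only: M_def)
    qed
    \<comment> \<open>p - V = (g/q^m - 1) V has order d + 1 in q, hence in w. The constant B may
      depend on k, m and g, since it does not enter the zero-free radius.\<close>
    have pV: "norm (poly p w - V w) \<le> B * K4 ^ Suc d * M * norm w ^ Suc d" if w: "w \<noteq> 0" "norm w < r" for w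
    proof -
      define q where "q = \<kappa> w"
      have wr: "norm w \<le> r" "norm w < \<delta>" "norm w \<le> \<delta> / 2" using w r(2) c(2) \<delta> by simp_all
      have q: "norm q < R" "inverse_j q = w" using \<kappa>_inv[OF wr(2)] by (simp_all add: q_def)
      have "q \<noteq> 0" using q(2) w(1) j0 by auto
      moreover have "norm q < 1" using q(1) R1 by simp
      ultimately obtain z where z: "Im z > 0" "qvar z = q" using qvar_surj by blast
      have zR: "norm (qvar z) < R" using q(1) z(2) by simp
      have "poly p w - V w = (g z / q ^ m - 1) * V w"
        using Wp[OF zR] unfolding z(2) q(2) V_def q_def [symmetric] by (simp add: algebra_simps)
      then have "norm (poly p w - V w) = norm (g z / q ^ m - 1) * norm (V w)" by (simp only: norm_mult)
      also have "\<dots> \<le> (B * norm q ^ Suc d) * M"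
        using B(2)[of z] Imz[OF zR] VM[OF wr(1)] B(1) unfolding z(2) by (intro mult_mono) auto
      also have "norm q ^ Suc d \<le> (K4 * norm w) ^ Suc d"
        using b\<kappa>[OF wr(3)] by (intro power_mono) (auto simp: q_def)
      then have "B * norm q ^ Suc d * M \<le> B * (K4 * norm w) ^ Suc d * M"
        using B(1) M by (intro mult_right_mono mult_left_mono) auto
      also have "\<dots> = B * K4 ^ Suc d * M * norm w ^ Suc d" by (simp only: power_mult_distrib mult_ac)
      finally show ?thesis by (simp only:)
    qed
    define q where "q = qvar z"
    have "norm q * 1 \<le> norm q * real k" using kp by (intro mult_left_mono) auto
    also have "\<dots> \<le> R / 2" unfolding q_def using zC C(3) by (rule order_trans)
    finally have q2: "norm q \<le> R / 2" by (simp only: mult_1_right)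
    have q: "norm q \<le> R / 2" "norm q < R" "norm q \<le> 1" using q2 R(1) R1 by linarith+
    have "norm (inverse_j_unit q) \<le> 1 + K1 * 1"
      by (rule order_trans[OF bu[OF q(1)]]) (use q(3) K1(1) in simp)
    then have "norm (inverse_j q) \<le> norm q * (1 + K1)"
      unfolding inverse_j_eq norm_mult by (intro mult_left_mono) auto
    then have "norm (inverse_j q) * (M + 2) * real k \<le> norm q * (1 + K1) * (M + 2) * real k"
      using M by (intro mult_right_mono) auto
    also have "\<dots> = norm q * real k * ((1 + K1) * (M + 2))" by (simp only: mult_ac)
    also have "\<dots> \<le> C * ((1 + K1) * (M + 2))"
      using zC K1(1) M unfolding q_def by (intro mult_right_mono) auto
    also have "\<dots> \<le> r * real k" using C(2) r(3) by simp
    finally have "norm (inverse_j q) * (M + 2) \<le> r" using kp by simp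
    moreover have "r < \<delta>" using r(2) c(2) \<delta> by simp
    moreover have "degree p \<le> d" unfolding p_def by (rule degree_reversed_poly)
    ultimately have "poly p (inverse_j q) \<noteq> 0"
      using taylor_poly_nonzero[OF V V0 r(1) _ VM r(1) pV] by blast
    then show "g z \<noteq> 0" using Wp[of z] q(2) by (auto simp: q_def)
  qed
qed

section \<open>Uniformity over all weights and the final estimate\<close>

lemma miller_form_zero_bound:
  obtains C where "C > 0"
    "\<And>k m g z. even k \<Longrightarrow> k \<ge> 4 \<Longrightarrow> m \<le> miller_ell k \<Longrightarrow> miller_form k m g \<Longrightarrow>
       norm (qvar z) * real k \<le> C \<Longrightarrow> g z \<noteq> 0"
proof -
  define P where "P = (\<lambda>(a, b) C. \<forall>k m g z. k \<ge> 4 \<longrightarrow> m \<le> miller_ell k \<longrightarrow> miller_form k m g \<longrightarrow>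
       k + 4 * a + 6 * b = 12 * (miller_ell k + (if a = 0 then 0 else 1) + (if b = 0 then 0 else 1)) \<longrightarrow>
       norm (qvar z) * real k \<le> C \<longrightarrow> g z \<noteq> 0)"
  have "\<exists>C>0. P ab C" for ab
  proof (cases ab)
    case (Pair a b)
    obtain C where "C > 0" "\<And>k m g z. k \<ge> 4 \<Longrightarrow> m \<le> miller_ell k \<Longrightarrow> miller_form k m g \<Longrightarrow>
       k + 4 * a + 6 * b = 12 * (miller_ell k + (if a = 0 then 0 else 1) + (if b = 0 then 0 else 1)) \<Longrightarrow>
       norm (qvar z) * real k \<le> C \<Longrightarrow> g z \<noteq> 0"
      by (rule miller_form_zero_bound_fixed_weight_class[of a b]) (rule that)
    then have "P ab C" unfolding P_def Pair by blast
    with \<open>C > 0\<close> show ?thesis by blast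
  qed
  then obtain f where f: "\<And>ab. f ab > 0" "\<And>ab. P ab (f ab)" by metis
  \<comment> \<open>The six pairs with a < 3 and b < 2 reach every even weight, so a finite minimum
    suffices.\<close>
  define C where "C = Min (f ` ({..<3} \<times> {..<2}))"
  have fin: "finite (f ` ({..<3} \<times> {..<2}))" "f ` ({..<3} \<times> {..<2}) \<noteq> {}"
    by (auto simp: lessThan_empty_iff)
  show ?thesis
  proof (rule that)
    show "C > 0" unfolding C_def Min_gr_iff[OF fin] using f(1) by blast
    fix k m g z
    assume k: "even k" "k \<ge> 4" and m: "m \<le> miller_ell k" and g: "miller_form k m g"
      and z: "norm (qvar z) * real k \<le> C"
    obtain a b where ab: "a < 3" "b < 2"
      "k + 4 * a + 6 * b = 12 * (miller_ell k + (if a = 0 then 0 else 1) + (if b = 0 then 0 else 1))"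
      by (rule weight_complement[OF k]) (rule that)
    have "C \<le> f (a, b)" unfolding C_def by (rule Min_le[OF fin(1)]) (use ab in auto)
    with z have "norm (qvar z) * real k \<le> f (a, b)" by (rule order_trans)
    with f(2)[of "(a, b)"] show "g z \<noteq> 0" unfolding P_def using k(2) m g ab(3) by simp
  qed
qed

text \<open>This makes 1 - c positive in the final bound; 2 pi < 7 and e < 2.72 are accurate
  enough.\<close>

lemma exp_2pi_less_1728: "exp (2 * pi) < 1728"
proof -
  have "exp (2 * pi) < exp (7 * 1)"
    using pi_less_4 pi_approx(2) by simp
  also have "\<dots> = exp 1 ^ 7" by (simp only: exp_of_nat_mult [symmetric] of_nat_numeral)
  also have "\<dots> \<le> (272/100) ^ 7"
    using e_less_272 by (intro power_mono) auto
  also have "\<dots> < 1728" by (simp add: power_numeral_reduce)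
  finally show ?thesis .
qed

theorem theoremC:
  shows "\<exists>C0::real. \<forall>k::nat. \<forall>m::nat. \<forall>g z.
           even k \<and> k \<ge> 4 \<and> m \<le> miller_ell k \<and> miller_form k m g \<and>
           z \<in> fund_domain \<and> g z = 0 \<longrightarrow>
           Im z < 2 * ln (real k) / (1 - exp (2 * pi) / 1728) + C0"
proof -
  obtain C where C: "C > 0"
    "\<And>k m g z. even k \<Longrightarrow> k \<ge> 4 \<Longrightarrow> m \<le> miller_ell k \<Longrightarrow> miller_form k m g \<Longrightarrow>
       norm (qvar z) * real k \<le> C \<Longrightarrow> g z \<noteq> 0"
    by (rule miller_form_zero_bound) (rule that)
  \<comment> \<open>Obtained by taking logarithms in C < k exp(-2 pi Im z).\<close>
  define C0 where "C0 = - ln C / (2 * pi)"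
  have "Im z < 2 * ln (real k) / (1 - exp (2 * pi) / 1728) + C0"
    if "even k \<and> k \<ge> 4 \<and> m \<le> miller_ell k \<and> miller_form k m g \<and> z \<in> fund_domain \<and> g z = 0" for k m g z
  proof -
    have k: "real k \<ge> 1" using that by auto
    have "\<not> norm (qvar z) * real k \<le> C" using C(2) that by blast
    then have "C < exp (- 2 * pi * Im z) * real k" by (simp only: norm_qvar not_le)
    then have "ln C < ln (exp (- 2 * pi * Im z) * real k)" using C(1) k by (subst ln_less_cancel_iff) auto
    also have "\<dots> = - 2 * pi * Im z + ln (real k)" using k by (subst ln_mult) auto
    finally have "2 * pi * Im z < ln (real k) - ln C" by simp
    then have "Im z < (ln (real k) - ln C) / (2 * pi)" by (simp add: field_simps)
    also have "\<dots> = ln (real k) / (2 * pi) + C0" by (simp add: C0_def diff_divide_distrib)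
    \<comment> \<open>Since 0 < 1 - c <= 1 <= 2 pi and log k >= 0, the sharper coefficient 1/(2 pi)
      may be enlarged to 2/(1 - c).\<close>
    also have "ln (real k) / (2 * pi) \<le> 2 * ln (real k) / (1 - exp (2 * pi) / 1728)"
    proof (rule frac_le)
      show "1 - exp (2 * pi) / 1728 > 0" using exp_2pi_less_1728 by simp
      have "1 - exp (2 * pi) / 1728 \<le> 1" by simp
      also have "1 \<le> 2 * pi" using pi_ge_two by simp
      finally show "1 - exp (2 * pi) / 1728 \<le> 2 * pi" .
    qed (use k in auto)
    finally show ?thesis by simp
  qed
  then show ?thesis by blast
qed

end
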